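(* Assume $\mathtt{P},\mathtt{P}',b$ are generic. The operator $\Phi^{\mathrm{H.V}}(z)$ satisfies, for all $n\in\mathbb{Z}$, $$[L_n,\Phi^{\mathrm{H.V}}(z)]=z^n\left(z\frac{\partial}{\partial z}+\alpha(Q-\alpha)(n+1)\right)\Phi^{\mathrm{H.V}}(z).$$ Moreover, $$[\beta^{(2)}_n,\Phi^{\mathrm{H.V}}(w)]=\sqrt{-1}\,w^n(Q-\alpha)\,\Phi^{\mathrm{H.V}}(w)\quad(n>0),\qquad [\beta^{(2)}_{-n},\Phi^{\mathrm{H.V}}(w)]=-\sqrt{-1}\,w^{-n}\alpha\,\Phi^{\mathrm{H.V}}(w)\quad(n\ge0).$$
   Context: Parameters. Put $q=e^{b^{-1}\hbar}$, $t=e^{-b\hbar}$, $u_i=e^{u_i'\hbar}$, $v_i=e^{v_i'\hbar}$ $(i=1,2)$, $\gamma=(t/q)^{1/2}$, $Q=b+b^{-1}$, where $u_i',v_i'$ are parametrized by $\mathtt{P},\mathtt{P}',\alpha$ so that $v_i'-u_j'=\mathtt{P}'_i-\mathtt{P}_j-\alpha$ for $i,j\in\{1,2\}$, with $\mathtt{P}_1=-\mathtt{P}_2=\mathtt{P}$, $\mathtt{P}'_1=-\mathtt{P}'_2=\mathtt{P}'$. Thus $u_1'-u_2'=2\mathtt{P}$, $v_1'-v_2'=2\mathtt{P}'$, $u_1'+u_2'-v_1'-v_2'=2\alpha$. Bosons. Let $\mathsf{a}^{(i)}_n$ $(i=1,2,\ n\in\mathbb{Z}_{\neq0})$ satisfy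 $[\mathsf{a}^{(i)}_n,\mathsf{a}^{(j)}_m]=-b^{-2}n\,\delta_{i,j}\delta_{n+m,0}$, and set, for $n>0$, $a^{(i)}_{-n}=\mathsf{a}^{(i)}_{-n}$, $a^{(i)}_n=(-b^2)\frac{1-q^n}{1-t^n}\mathsf{a}^{(i)}_n$, so that $[a^{(i)}_n,a^{(j)}_m]=n\frac{1-q^{|n|}}{1-t^{|n|}}\delta_{i,j}\delta_{n+m,0}$. Let $\mathcal{F}_{\boldsymbol{u}}$ and $\mathcal{F}_{\boldsymbol{v}}$ be two copies of the Fock space of these bosons, generated from the vacuum $|\boldsymbol{0}\rangle$ killed by positive modes, labelled by $\boldsymbol{u}=(u_1,u_2)$ and $\boldsymbol{v}=(v_1,v_2)$; $\langle\boldsymbol{0}|$ is the dual vacuum with $\langle\boldsymbol{0}|\boldsymbol{0}\rangle=1$. The operators $X^{(1)},X^{(2)}$. On $\mathcal{F}_{\boldsymbol{u}}$: $X^{(1)}(z)=u_1\Lambda^{(1)}(z)+u_2\Lambda^{(2)}(z)$, $X^{(2)}(z)=u_1u_2:\Lambda^{(1)}(z)\Lambda^{(2)}(qz/t):$, where, with $\eta^{(i)}(z)=e^{\sum_{n>0}\frac{1-t^{-n}}{n}a^{(i)}_{-n}z^n}e^{-\sum_{n>0}\frac{1-t^n}{n}a^{(i)}_nz^{-n}}$, $$\Lambda^{(1)}(z)=\eta^{(1)}(z),\qquad \Lambda^{(2)}(z)=e^{\sum_{n>0}\frac{1-t^{-n}}{n}(1-t^nq^{-n})a^{(1)}_{-n}z^n}\,\eta^{(2)}(\gamma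 z).$$ On $\mathcal{F}_{\boldsymbol{v}}$ the same with $u_i$ replaced by $v_i$. The vertex operator. $\mathcal{V}(x):\mathcal{F}_{\boldsymbol{u}}\to\mathcal{F}_{\boldsymbol{v}}$ is the unique (it is known to exist) linear operator with $\langle\boldsymbol{0}|\mathcal{V}(x)|\boldsymbol{0}\rangle=1$ and $$\Big(1-\frac xz\Big)X^{(i)}(z)\mathcal{V}(x)=\Big(1-(t/q)^i\frac xz\Big)\mathcal{V}(x)X^{(i)}(z)\qquad(i=1,2).$$ It is known to have no pole at $\hbar=0$ (matrix elements with respect to the $\hbar$-independent bosons $\mathsf{a}^{(i)}_n$): $\mathcal{V}(z)=\mathcal{V}_0(z)+\mathcal{V}_1(z)\hbar+\mathcal{V}_2(z)\hbar^2+\cdots$. Define $$\Phi^{\mathrm{H.V}}(z)=z^{-\mathtt{P}'^2+\mathtt{P}^2-\alpha(Q-\alpha)}\,\mathcal{V}_0(z).$$ Heisenberg and Virasoro generators. For $n\ne0$: $\beta^{(1)}_n=-\frac{\sqrt{-1}}2b(\mathsf{a}^{(1)}_n-\mathsf{a}^{(2)}_n)$, $\beta^{(2)}_n=-\frac{\sqrt{-1}}2b(\mathsf{a}^{(1)}_n+\mathsf{a}^{(2)}_n)$. Zero modes: $\beta^{(1)}_0=\sqrt{-1}\,\frac{u_1'-u_2'}2$, $\beta^{(2)}_0=\sqrt{-1}\,\frac{u_1'+u_2'}2$ on $\mathcal{F}_{\boldsymbol{u}}$, and the same with $v_i'$ in place of $u_i'$ on $\mathcal{F}_{\boldsymbol{v}}$.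 For $n>0$ put $b'_{-n}=\frac{1-t^{-n}}{1+(q/t)^n}(a^{(1)}_{-n}-\gamma^{-n}a^{(2)}_{-n})$, $b'_n=-\frac{1-t^n}{1+(q/t)^n}(a^{(1)}_n-\gamma^{-n}a^{(2)}_n)$, and let $$T(z)=\,:e^{\sum_{n\ne0}\frac{b'_n}{|n|}z^{-n}}:\,e^{-\sqrt{-1}\hbar\beta^{(1)}_0}+:e^{-\sum_{n\ne0}\frac{b'_n}{|n|}(t/q)^nz^{-n}}:\,e^{\sqrt{-1}\hbar\beta^{(1)}_0}.$$ The operator $L(z)=\sum_{n\in\mathbb{Z}}L_nz^{-n}$ is defined by the expansion $T(z)=2-\big(L(z)-\frac{Q^2}4\big)\hbar^2+\mathcal{O}(\hbar^4)$; it is known that the $L_n$ satisfy the Virasoro relations with central charge $1+6Q^2$. In the commutators, operators to the left (right) of $\Phi^{\mathrm{H.V}}$ act on $\mathcal{F}_{\boldsymbol{v}}$ ($\mathcal{F}_{\boldsymbol{u}}$).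
   Formalization: As printed the L_n formula is false: L_n commutes with all β^(2)_m. Here z∂/∂z is replaced by z∂/∂z minus the commutator with 2∑_{n>0}β^(2)_{-n}β^(2)_n (it acts on the Virasoro factor only), and the second exponential of T(z) has (q/t)^n in place of (t/q)^n. *)

theory Defs
  imports
    "HOL-Analysis.Analysis"
    "HOL-Library.Multiset"
    "HOL-Computational_Algebra.Formal_Laurent_Series"
begin

section \<open>Parameters\<close>

text \<open>The deformed objects depend on \<open>\<hbar>\<close> through exponentials; they are expanded at
  \<open>\<hbar> = 0\<close>, so the base field is the field of formal Laurent series in \<open>\<hbar>\<close> over the
  complex numbers.\<close>

type_synonym hser = "complex fls"

definition hexp :: "complex \<Rightarrow> hser" where \<comment> \<open>\<open>e\<^bsup>c\<hbar>\<^esup>\<close>\<close>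
  "hexp c = fps_to_fls (fps_exp c)"

definition q_par :: "complex \<Rightarrow> hser" where
  "q_par b = hexp (1 / b)"

definition t_par :: "complex \<Rightarrow> hser" where
  "t_par b = hexp (- b)"

definition gamma_par :: "complex \<Rightarrow> hser" where \<comment> \<open>the root of \<open>t/q\<close> with constant term 1\<close>
  "gamma_par b = hexp (- (b + 1 / b) / 2)"

definition Q_par :: "complex \<Rightarrow> complex" where
  "Q_par b = b + 1 / b"

text \<open>Genericity: \<open>q\<^sup>m t\<^sup>n = 1\<close> only for \<open>m = n = 0\<close>, and neither \<open>u\<^sub>1/u\<^sub>2 = e\<^bsup>2P\<hbar>\<^esup>\<close> nor
  \<open>v\<^sub>1/v\<^sub>2 = e\<^bsup>2P'\<hbar>\<^esup>\<close> is of the form \<open>q\<^sup>m t\<^sup>n\<close> with integers \<open>m, n\<close>.\<close>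

definition generic :: "complex \<Rightarrow> complex \<Rightarrow> complex \<Rightarrow> bool" where
  "generic b P P' \<longleftrightarrow> b \<noteq> 0 \<and> b\<^sup>2 \<notin> \<rat>
     \<and> (\<forall>m n :: int. 2 * P \<noteq> of_int m / b - of_int n * b)
     \<and> (\<forall>m n :: int. 2 * P' \<noteq> of_int m / b - of_int n * b)"

section \<open>Fock space\<close>

datatype idx = One | Two

text \<open>The element \<open>(i, k)\<close> of a multiset stands for the creation operator \<open>a\<^sup>(\<^sup>i\<^sup>)\<close> of mode
  \<open>-(k+1)\<close>; a multiset is the corresponding monomial applied to the vacuum, and the empty
  multiset is the vacuum. All functions on monomials form the completed Fock space (direct
  product of the graded pieces), the finitely supported ones the Fock space itself. The
  coefficient at the empty multiset is the pairing with the dual vacuum.\<close>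

type_synonym mono = "(idx \<times> nat) multiset"
type_synonym 'k vec = "mono \<Rightarrow> 'k"

definition weight :: "mono \<Rightarrow> nat" where
  "weight \<mu> = (\<Sum>(i, k)\<in>#\<mu>. Suc k)"

definition basis :: "mono \<Rightarrow> 'k::field vec" where
  "basis \<nu> = (\<lambda>\<mu>. if \<mu> = \<nu> then 1 else 0)"

text \<open>The boson of mode \<open>n \<noteq> 0\<close>, with \<open>[boson c i n, boson c j m] = c n\<close> if \<open>i = j\<close> and
  \<open>n + m = 0\<close>, and \<open>0\<close> otherwise.\<close>

definition boson :: "'k::field \<Rightarrow> idx \<Rightarrow> int \<Rightarrow> 'k vec \<Rightarrow> 'k vec" where
  "boson c i n f = (\<lambda>\<mu>. let p = (i, nat \<bar>n\<bar> - 1) in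
     if n < 0 then (if p \<in># \<mu> then f (\<mu> - {#p#}) else 0)
     else if n > 0 then c * of_int n * of_nat (count \<mu> p + 1) * f (add_mset p \<mu>)
     else 0)"

definition a_mode :: "complex \<Rightarrow> idx \<Rightarrow> int \<Rightarrow> hser vec \<Rightarrow> hser vec" where
  "a_mode b i n f = (\<lambda>\<mu>.
     (if n > 0 then fls_const (- (b\<^sup>2)) * (1 - q_par b powi n) / (1 - t_par b powi n) else 1)
       * boson (fls_const (- 1 / b\<^sup>2)) i n f \<mu>)"

section \<open>Normal ordered exponentials\<close>

text \<open>\<open>J :: current\<close> encodes \<open>J(z) = \<Sum>\<^sub>i \<Sum>\<^bsub>n\<noteq>0\<^esub> J i n a\<^sup>(\<^sup>i\<^sup>)\<^sub>n z\<^bsup>-n\<^esup>\<close> in terms of \<open>a_mode\<close>.\<close>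

type_synonym current = "idx \<Rightarrow> int \<Rightarrow> hser"

definition shift_arg :: "hser \<Rightarrow> current \<Rightarrow> current" where \<comment> \<open>\<open>J(z)\<close> becomes \<open>J(sz)\<close>\<close>
  "shift_arg s J = (\<lambda>i n. s powi (- n) * J i n)"

text \<open>With \<open>s = -1\<close> (creation part) or \<open>s = 1\<close> (annihilation part), \<open>half_pow b s J k N\<close> is the
  coefficient of \<open>z\<^bsup>-sN\<^esup>\<close> in the \<open>k\<close>-th power of \<open>\<Sum>\<^sub>i \<Sum>\<^bsub>n>0\<^esub> J i (sn) a\<^sup>(\<^sup>i\<^sup>)\<^bsub>sn\<^esub> z\<^bsup>-sn\<^esup>\<close>, and
  \<open>half_exp b s J N\<close> is the same coefficient in its exponential.\<close>

primrec half_pow ::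
  "complex \<Rightarrow> int \<Rightarrow> current \<Rightarrow> nat \<Rightarrow> nat \<Rightarrow> hser vec \<Rightarrow> hser vec" where
  "half_pow b s J 0 N f = (\<lambda>\<mu>. if N = 0 then f \<mu> else 0)"
| "half_pow b s J (Suc k) N f = (\<lambda>\<mu>. \<Sum>n\<in>{1..N}. \<Sum>i\<in>{One, Two}.
     J i (s * int n) * a_mode b i (s * int n) (half_pow b s J k (N - n) f) \<mu>)"

definition half_exp :: "complex \<Rightarrow> int \<Rightarrow> current \<Rightarrow> nat \<Rightarrow> hser vec \<Rightarrow> hser vec" where
  "half_exp b s J N f = (\<lambda>\<mu>. \<Sum>k\<le>N. half_pow b s J k N f \<mu> / fact k)"

text \<open>Coefficient of \<open>z\<^bsup>-n\<^esup>\<close> in \<open>:e\<^bsup>J(z)\<^esup>:\<close>. The creation part of order \<open>r\<close> raises the weight by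
  \<open>r\<close>, so the terms with \<open>r > weight \<mu>\<close> do not contribute to the coefficient at \<open>\<mu>\<close>. A normal
  ordered product of such exponentials is the normal ordered exponential of the sum of the
  currents.\<close>

definition nexp :: "complex \<Rightarrow> current \<Rightarrow> int \<Rightarrow> hser vec \<Rightarrow> hser vec" where
  "nexp b J n f = (\<lambda>\<mu>. \<Sum>r\<le>weight \<mu>. if int r + n \<ge> 0
     then half_exp b (- 1) J r (half_exp b 1 J (nat (int r + n)) f) \<mu> else 0)"

section \<open>The operators \<open>X\<close>\<close>

definition eta_cur :: "complex \<Rightarrow> idx \<Rightarrow> current" where
  "eta_cur b i = (\<lambda>j n. if j \<noteq> i then 0
     else if n < 0 then (1 - t_par b powi n) / of_int (- n)
     else - (1 - t_par b powi n) / of_int n)"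

definition Lambda1_cur :: "complex \<Rightarrow> current" where
  "Lambda1_cur b = eta_cur b One"

definition Lambda2_cur :: "complex \<Rightarrow> current" where
  "Lambda2_cur b = (\<lambda>j n.
     (if j = One \<and> n < 0
      then (1 - t_par b powi n) / of_int (- n) * (1 - t_par b powi (- n) * q_par b powi n) else 0)
     + shift_arg (gamma_par b) (eta_cur b Two) j n)"

text \<open>\<open>X_mode b w i n\<close> is the coefficient of \<open>z\<^bsup>-n\<^esup>\<close> in \<open>X\<^sup>(\<^sup>i\<^sup>)(z)\<close> on the Fock space with labels
  \<open>e\<^bsup>w One \<hbar>\<^esup>, e\<^bsup>w Two \<hbar>\<^esup>\<close>, for \<open>i = 1, 2\<close>.\<close>

definition X_mode :: "complex \<Rightarrow> (idx \<Rightarrow> complex) \<Rightarrow> nat \<Rightarrow> int \<Rightarrow> hser vec \<Rightarrow> hser vec" where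
  "X_mode b w i n f = (\<lambda>\<mu>. if i = 1
     then hexp (w One) * nexp b (Lambda1_cur b) n f \<mu> + hexp (w Two) * nexp b (Lambda2_cur b) n f \<mu>
     else hexp (w One) * hexp (w Two) * nexp b (\<lambda>j m. Lambda1_cur b j m
            + shift_arg (q_par b / t_par b) (Lambda2_cur b) j m) n f \<mu>)"

section \<open>The vertex operator\<close>

text \<open>A linear map from the Fock space to the completed Fock space is given by the images
  \<open>V \<nu>\<close> of the monomials; \<open>V \<nu> \<mu>\<close> is its matrix element. \<open>extend V\<close> is the map itself,
  to be used on finitely supported vectors only.\<close>

type_synonym 'k lmap = "mono \<Rightarrow> 'k vec"

definition extend :: "'k::field lmap \<Rightarrow> 'k vec \<Rightarrow> 'k vec" where
  "extend V f = (\<lambda>\<mu>. \<Sum>\<nu> | f \<nu> \<noteq> 0. f \<nu> * V \<nu> \<mu>)"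

text \<open>The defining relations, read off at each power \<open>z\<^bsup>-n\<^esup>\<close>; \<open>u\<close> and \<open>v\<close> are the exponents
  \<open>u'\<close> and \<open>v'\<close> of the labels.\<close>

definition intertwiner ::
  "complex \<Rightarrow> (idx \<Rightarrow> complex) \<Rightarrow> (idx \<Rightarrow> complex) \<Rightarrow> complex \<Rightarrow> hser lmap \<Rightarrow> bool" where
  "intertwiner b u v x V \<longleftrightarrow> V {#} {#} = 1 \<and>
     (\<forall>i\<in>{1, 2}. \<forall>n \<nu> \<mu>.
        X_mode b v i n (V \<nu>) \<mu> - fls_const x * X_mode b v i (n - 1) (V \<nu>) \<mu>
      = extend V (X_mode b u i n (basis \<nu>)) \<mu>
        - (t_par b / q_par b) ^ i * fls_const x * extend V (X_mode b u i (n - 1) (basis \<nu>)) \<mu>)"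

definition vertex_op ::
  "complex \<Rightarrow> (idx \<Rightarrow> complex) \<Rightarrow> (idx \<Rightarrow> complex) \<Rightarrow> complex \<Rightarrow> hser lmap" where
  "vertex_op b u v x = (THE V. intertwiner b u v x V)"

text \<open>\<open>\<Phi>(z)\<close>, with the complex power of \<open>z\<close> taken with respect to a branch \<open>lg\<close> of the
  logarithm; the constant coefficient in \<open>\<hbar>\<close> of the vertex operator is the operator
  \<open>V\<^sub>0(z)\<close>.\<close>

definition Phi_HV :: "complex \<Rightarrow> complex \<Rightarrow> complex \<Rightarrow> complex \<Rightarrow> (idx \<Rightarrow> complex) \<Rightarrow> (idx \<Rightarrow> complex)
    \<Rightarrow> (complex \<Rightarrow> complex) \<Rightarrow> complex \<Rightarrow> complex lmap" where
  "Phi_HV b P P' \<alpha> u v lg z = (\<lambda>\<nu> \<mu>.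
     exp ((- P'\<^sup>2 + P\<^sup>2 - \<alpha> * (Q_par b - \<alpha>)) * lg z) * fls_nth (vertex_op b u v z \<nu> \<mu>) 0)"

section \<open>Heisenberg and Virasoro generators\<close>

definition beta1_zero :: "(idx \<Rightarrow> complex) \<Rightarrow> complex" where
  "beta1_zero w = \<i> * (w One - w Two) / 2"

definition beta2 :: "complex \<Rightarrow> (idx \<Rightarrow> complex) \<Rightarrow> int \<Rightarrow> complex vec \<Rightarrow> complex vec" where
  "beta2 b w n f = (\<lambda>\<mu>. if n = 0 then \<i> * (w One + w Two) / 2 * f \<mu>
     else - (\<i> / 2) * b * (boson (- 1 / b\<^sup>2) One n f \<mu> + boson (- 1 / b\<^sup>2) Two n f \<mu>))"

text \<open>\<open>\<Sum>\<^bsub>n\<noteq>0\<^esub> b'\<^sub>n/|n| z\<^bsup>-n\<^esup>\<close>\<close>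

definition bprime_cur :: "complex \<Rightarrow> current" where
  "bprime_cur b = (\<lambda>j n.
     (if n < 0 then 1 else - 1) * (1 - t_par b powi n) / (1 + (q_par b / t_par b) powi \<bar>n\<bar>)
     * (if j = One then 1 else - (gamma_par b powi (- \<bar>n\<bar>))) / of_int \<bar>n\<bar>)"

text \<open>\<open>T(z)\<close>, the factor of \<open>X\<^sup>(\<^sup>1\<^sup>)(z)\<close> left after splitting off the exponential in the bosons that
  commute with all \<open>b'\<^sub>n\<close>. That splitting, like the relation \<open>Y\<^sub>1(z) Y\<^sub>2(qz/t) = 1\<close> between the two
  exponentials implied by \<open>X\<^sup>(\<^sup>2\<^sup>)\<close>, makes the second exponential the inverse of the first one at
  \<open>tz/q\<close>, that is \<open>-\<Sum> b'\<^sub>n/|n| (q/t)\<^sup>n z\<^bsup>-n\<^esup>\<close>. With \<open>(t/q)\<^sup>n\<close> in place of \<open>(q/t)\<^sup>n\<close> the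
  background charge of \<open>L(z)\<close> changes sign and \<open>\<Phi>\<close> is not primary.\<close>

definition T_mode :: "complex \<Rightarrow> (idx \<Rightarrow> complex) \<Rightarrow> int \<Rightarrow> hser vec \<Rightarrow> hser vec" where
  "T_mode b w n f = (\<lambda>\<mu>.
     nexp b (bprime_cur b) n f \<mu> * hexp (- \<i> * beta1_zero w)
     + nexp b (\<lambda>j m. - bprime_cur b j m * (q_par b / t_par b) powi m) n f \<mu>
         * hexp (\<i> * beta1_zero w))"

text \<open>\<open>L\<^sub>n - (Q\<^sup>2/4) \<delta>\<^bsub>n,0\<^esub>\<close> is minus the coefficient of \<open>\<hbar>\<^sup>2\<close> in \<open>T\<^sub>n\<close>, the bosons \<open>boson\<close> being
  independent of \<open>\<hbar>\<close>.\<close>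

definition L_mode :: "complex \<Rightarrow> (idx \<Rightarrow> complex) \<Rightarrow> int \<Rightarrow> complex vec \<Rightarrow> complex vec" where
  "L_mode b w n f = (\<lambda>\<mu>. (if n = 0 then (Q_par b)\<^sup>2 / 4 * f \<mu> else 0)
     - fls_nth (T_mode b w n (\<lambda>\<nu>. fls_const (f \<nu>)) \<mu>) 2)"

text \<open>The degree operator \<open>2 \<Sum>\<^bsub>n>0\<^esub> \<beta>\<^sup>(\<^sup>2\<^sup>)\<^bsub>-n\<^esub> \<beta>\<^sup>(\<^sup>2\<^sup>)\<^sub>n\<close> of the Heisenberg modes; as
  \<open>[\<beta>\<^sup>(\<^sup>2\<^sup>)\<^sub>n, \<beta>\<^sup>(\<^sup>2\<^sup>)\<^bsub>-n\<^esub>] = n/2\<close>, it satisfies \<open>[d, \<beta>\<^sup>(\<^sup>2\<^sup>)\<^bsub>-n\<^esub>] = n \<beta>\<^sup>(\<^sup>2\<^sup>)\<^bsub>-n\<^esub>\<close>. Terms with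
  \<open>n > weight \<mu>\<close> vanish at \<open>\<mu>\<close>; the zero mode does not enter, whence the label is irrelevant.\<close>

definition heis_degree :: "complex \<Rightarrow> complex vec \<Rightarrow> complex vec" where
  "heis_degree b f = (\<lambda>\<mu>. 2 * (\<Sum>n\<in>{1..weight \<mu>}.
     beta2 b (\<lambda>_. 0) (- int n) (beta2 b (\<lambda>_. 0) (int n) f) \<mu>))"

text \<open>Matrix elements of \<open>A F - F B\<close>, where \<open>A\<close> acts on the target and \<open>B\<close> on the source.\<close>

definition commut ::
  "('k::field vec \<Rightarrow> 'k vec) \<Rightarrow> ('k vec \<Rightarrow> 'k vec) \<Rightarrow> 'k lmap \<Rightarrow> 'k lmap" where
  "commut A B F = (\<lambda>\<nu> \<mu>. A (F \<nu>) \<mu> - extend F (B (basis \<nu>)) \<mu>)"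

text \<open>\<open>\<Phi>(z)\<close> is the product of a vertex operator in the modes of \<open>\<beta>\<^sup>(\<^sup>2\<^sup>)\<close> and an operator commuting
  with them, which carries the prefactor of \<open>\<Phi>\<close>. \<open>vir_deriv\<close> is \<open>z \<partial>/\<partial>z\<close> acting on the latter
  factor: on the former one \<open>z \<partial>/\<partial>z\<close> is the commutator with the Heisenberg degree, which is
  subtracted from the full derivative. The \<open>L\<^sub>n\<close> commute with \<open>\<beta>\<^sup>(\<^sup>2\<^sup>)\<^sub>m\<close>, so by the Jacobi identity
  their commutators with \<open>\<Phi>\<close> can only involve this derivative. The two derivatives agree on
  matrix elements between vectors without \<open>\<beta>\<^sup>(\<^sup>2\<^sup>)\<close> excitations.\<close>

definition vir_deriv :: "complex \<Rightarrow> (complex \<Rightarrow> complex lmap) \<Rightarrow> complex \<Rightarrow> complex lmap" where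
  "vir_deriv b F z = (\<lambda>\<nu> \<mu>. z * deriv (\<lambda>y. F y \<nu> \<mu>) z
     - commut (heis_degree b) (heis_degree b) (F z) \<nu> \<mu>)"

end

theory Submission
  imports Defs
begin

text \<open>Write \<open>V = V\<^sub>0 + V\<^sub>1\<hbar> + V\<^sub>2\<hbar>\<^sup>2 + \<dots>\<close> and expand both intertwining relations up to order \<open>\<hbar>\<^sup>2\<close>.
  At order \<open>\<hbar>\<close> the relation for \<open>X\<^sup>(\<^sup>2\<^sup>)\<close> is a two-term recurrence for the commutators of \<open>V\<^sub>0\<close> with
  the Heisenberg modes \<open>\<phi>\<^sub>n = -2i \<beta>\<^sup>(\<^sup>2\<^sup>)\<^sub>n\<close>; it is solved from \<open>n = 0\<close>, where \<open>\<phi>\<^sub>0\<close> is a scalar. At order \<open>\<hbar>\<^sup>2\<close>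
  the operator \<open>V\<^sub>1\<close> enters both relations through the same commutator with \<open>\<phi>\<close> and drops out of their
  difference. Since the coefficient of \<open>\<hbar>\<^sup>2\<close> in \<open>X\<^sup>(\<^sup>1\<^sup>) - X\<^sup>(\<^sup>2\<^sup>)\<close> is
  \<open>Q\<^sup>2/4 - L(z) - :\<phi>(z)\<^sup>2:/4 - (Q/2) z\<partial>\<phi>(z)\<close> and the commutators with \<open>\<phi>\<close> are known, what remains is
  \<open>[L\<^sub>n, V\<^sub>0] - x [L\<^bsub>n-1\<^esub>, V\<^sub>0] = x\<^sup>n \<alpha>(Q - \<alpha>) V\<^sub>0\<close>. The case \<open>n = 0\<close> holds because \<open>L\<^sub>0\<close> plus the
  Heisenberg degree is the total degree up to a scalar, while uniqueness of \<open>V\<close> makes \<open>V\<^sub>0\<close>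
  homogeneous in \<open>x\<close>.\<close>

section \<open>Expansion of the currents\<close>

text \<open>The order stops at hbar^2 because \<open>L_mode\<close> reads off exactly that
  coefficient; excluding negative powers makes the truncation compatible with products.\<close>

definition jet :: "hser \<Rightarrow> complex \<Rightarrow> complex \<Rightarrow> complex \<Rightarrow> bool" where
  "jet x c0 c1 c2 \<longleftrightarrow> (\<forall>k<0. fls_nth x k = 0) \<and> fls_nth x 0 = c0 \<and> fls_nth x 1 = c1 \<and> fls_nth x 2 = c2"

lemma jet_regular: "(\<And>k. k < 0 \<Longrightarrow> fls_nth x k = 0) \<Longrightarrow> jet x (fls_nth x 0) (fls_nth x 1) (fls_nth x 2)"
  by (simp add: jet_def)

lemma jet_cong: "jet x c0 c1 c2 \<Longrightarrow> c0 = d0 \<Longrightarrow> c1 = d1 \<Longrightarrow> c2 = d2 \<Longrightarrow> jet x d0 d1 d2"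
  by simp

lemma jet_fps: "jet (fps_to_fls X) (fps_nth X 0) (fps_nth X 1) (fps_nth X 2)"
  by (simp add: jet_def)

lemma jet_fpsE:
  assumes "jet x c0 c1 c2"
  obtains X where "x = fps_to_fls X" "c0 = fps_nth X 0" "c1 = fps_nth X 1" "c2 = fps_nth X 2"
proof -
  have "x = fps_to_fls (fls_regpart x)"
    using assms by (intro fls_eqI) (auto simp: jet_def)
  with assms show ?thesis
    by (intro that[of "fls_regpart x"]) (auto simp: jet_def)
qed

lemma jet_mult:
  assumes "jet x c0 c1 c2" "jet y d0 d1 d2"
  shows "jet (x * y) (c0 * d0) (c0 * d1 + c1 * d0) (c0 * d2 + c1 * d1 + c2 * d0)"
proof -
  obtain X where X: "x = fps_to_fls X" "c0 = fps_nth X 0" "c1 = fps_nth X 1" "c2 = fps_nth X 2"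
    using assms(1) by (rule jet_fpsE)
  obtain Y where Y: "y = fps_to_fls Y" "d0 = fps_nth Y 0" "d1 = fps_nth Y 1" "d2 = fps_nth Y 2"
    using assms(2) by (rule jet_fpsE)
  show ?thesis
    using jet_fps[of "X * Y"]
    by (simp add: X Y fls_times_fps_to_fls fps_mult_nth eval_nat_numeral)
qed

lemma jet_add: "jet x c0 c1 c2 \<Longrightarrow> jet y d0 d1 d2 \<Longrightarrow> jet (x + y) (c0 + d0) (c1 + d1) (c2 + d2)"
  and jet_diff: "jet x c0 c1 c2 \<Longrightarrow> jet y d0 d1 d2 \<Longrightarrow> jet (x - y) (c0 - d0) (c1 - d1) (c2 - d2)"
  and jet_uminus: "jet x c0 c1 c2 \<Longrightarrow> jet (- x) (- c0) (- c1) (- c2)"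
  by (simp_all add: jet_def)

lemma jet_const: "jet (fls_const c) c 0 0"
  by (simp add: jet_def)

lemma jet_0: "jet 0 0 0 0" and jet_1: "jet 1 1 0 0"
  by (simp_all add: jet_def)

lemma jet_const_mult: "jet x c0 c1 c2 \<Longrightarrow> jet (fls_const c * x) (c * c0) (c * c1) (c * c2)"
  by (simp add: jet_def)

lemma jet_sum:
  assumes "\<And>i. i \<in> A \<Longrightarrow> jet (f i) (c0 i) (c1 i) (c2 i)"
  shows "jet (sum f A) (sum c0 A) (sum c1 A) (sum c2 A)"
  using assms by (induction A rule: infinite_finite_induct) (auto intro: jet_0 jet_add)

lemma jet_unique: "jet x c0 c1 c2 \<Longrightarrow> jet x d0 d1 d2 \<Longrightarrow> c0 = d0 \<and> c1 = d1 \<and> c2 = d2"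
  by (simp add: jet_def)

text \<open>Only the constant term is determined; in \<open>bprime_jet\<close> it meets a factor of
  order hbar, so it already fixes the first-order coefficient.\<close>

lemma jet_inverse:
  assumes "jet x c0 c1 c2" "c0 \<noteq> 0"
  obtains d1 d2 where "jet (inverse x) (inverse c0) d1 d2"
proof -
  have x: "x \<noteq> 0" and "fls_subdegree x = 0"
    using assms by (auto simp: jet_def intro!: fls_subdegree_eqI)
  then have "fls_subdegree (inverse x) = 0" by simp
  then have j: "jet (inverse x) (fls_nth (inverse x) 0) (fls_nth (inverse x) 1) (fls_nth (inverse x) 2)"
    by (intro jet_regular) simp
  have "jet 1 (c0 * fls_nth (inverse x) 0)
     (c0 * fls_nth (inverse x) 1 + c1 * fls_nth (inverse x) 0)
     (c0 * fls_nth (inverse x) 2 + c1 * fls_nth (inverse x) 1 + c2 * fls_nth (inverse x) 0)"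
    using jet_mult[OF assms(1) j] x by simp
  then have "c0 * fls_nth (inverse x) 0 = 1"
    using jet_1 jet_unique by blast
  then have "fls_nth (inverse x) 0 = inverse c0"
    by (simp add: assms(2) inverse_eq_divide eq_divide_eq mult.commute)
  with j that show ?thesis by simp
qed

section \<open>Exponentials in hbar and the ratios of q and t\<close>

lemma jet_hexp: "jet (hexp c) 1 c (c\<^sup>2 / 2)"
  using jet_fps[of "fps_exp c"] by (simp add: hexp_def fact_numeral)

lemma hexp_add: "hexp (c + d) = hexp c * hexp d"
  by (simp add: hexp_def fps_exp_add_mult fls_times_fps_to_fls)

lemma hexp_0 [simp]: "hexp 0 = 1"
  by (simp add: hexp_def)

lemma hexp_nonzero [simp]: "hexp c \<noteq> 0"
  by (simp add: hexp_def)

lemma hexp_minus: "hexp (- c) = inverse (hexp c)"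
  using hexp_add[of "- c" c] by (simp add: field_simps)

lemma hexp_diff: "hexp (c - d) = hexp c / hexp d"
  using hexp_add[of c "- d"] by (simp add: hexp_minus field_simps)

lemma hexp_power: "hexp c ^ n = hexp (of_nat n * c)"
  by (induction n) (simp_all add: hexp_add algebra_simps)

lemma hexp_powi: "hexp c powi n = hexp (of_int n * c)"
  by (cases "n \<ge> 0") (simp_all add: power_int_def hexp_power hexp_minus[symmetric])

lemma hexp_neq_1: "c \<noteq> 0 \<Longrightarrow> hexp c \<noteq> 1"
  using jet_hexp[of c] jet_1 jet_unique by fastforce

lemma q_over_t: "q_par b / t_par b = hexp (Q_par b)"
  by (simp add: q_par_def t_par_def Q_par_def hexp_diff[symmetric] add.commute)

lemma t_over_q: "t_par b / q_par b = hexp (- Q_par b)"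
  by (simp add: q_par_def t_par_def Q_par_def hexp_diff[symmetric] algebra_simps)

text \<open>The coefficients of a current with respect to the \<open>\<hbar>\<close>-independent bosons.\<close>

definition boson_coeff :: "complex \<Rightarrow> current \<Rightarrow> idx \<Rightarrow> int \<Rightarrow> hser" where
  "boson_coeff b J i n = J i n *
     (if n > 0 then fls_const (- (b\<^sup>2)) * (1 - q_par b powi n) / (1 - t_par b powi n) else 1)"

text \<open>All currents here start at order hbar with a leading coefficient that does not depend on
  the mode; the mode enters only at second order.\<close>

definition current_jet :: "complex \<Rightarrow> current \<Rightarrow> (idx \<Rightarrow> complex) \<Rightarrow> (idx \<Rightarrow> int \<Rightarrow> complex) \<Rightarrow> bool" where
  "current_jet b J c d \<longleftrightarrow> (\<forall>i n. n \<noteq> 0 \<longrightarrow> jet (boson_coeff b J i n) 0 (c i) (d i n))"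

lemma current_jetD:
  "current_jet b J c d \<Longrightarrow> n \<noteq> 0 \<Longrightarrow> jet (boson_coeff b J i n) 0 (c i) (d i n)"
  by (simp add: current_jet_def)

lemma current_jet_cong:
  assumes "current_jet b J c d" "\<And>i. c i = c' i" "\<And>i n. n \<noteq> 0 \<Longrightarrow> d i n = d' i n"
  shows "current_jet b J c' d'"
  using assms by (simp add: current_jet_def)

text \<open>Mode n is multiplied by e^{-n s hbar}. Since the current starts at order hbar, this is
  felt only at order hbar^2, by -s n times the leading coefficient.\<close>

lemma current_jet_shift:
  assumes "current_jet b J c d"
  shows "current_jet b (shift_arg (hexp s) J) c (\<lambda>i n. d i n - s * of_int n * c i)"
  unfolding current_jet_def
proof (intro allI impI)
  fix i and n :: int assume "n \<noteq> 0"
  then have "jet (boson_coeff b J i n) 0 (c i) (d i n)"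
    using assms by (auto simp: current_jet_def)
  from jet_mult[OF jet_hexp[of "- of_int n * s"] this]
  show "jet (boson_coeff b (shift_arg (hexp s) J) i n) 0 (c i) (d i n - s * of_int n * c i)"
    by (simp add: boson_coeff_def shift_arg_def hexp_powi mult_ac)
qed

lemma current_jet_add:
  assumes "current_jet b J c d" "current_jet b J' c' d'"
  shows "current_jet b (\<lambda>i n. J i n + J' i n) (\<lambda>i. c i + c' i) (\<lambda>i n. d i n + d' i n)"
  using assms by (simp only: current_jet_def boson_coeff_def distrib_right)
    (metis jet_add add_0)

lemma current_jet_uminus:
  assumes "current_jet b J c d"
  shows "current_jet b (\<lambda>i n. - J i n) (\<lambda>i. - c i) (\<lambda>i n. - d i n)"
  using assms by (simp only: current_jet_def boson_coeff_def mult_minus_left)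
    (metis jet_uminus minus_zero)

lemma one_minus_t_powi: "b \<noteq> 0 \<Longrightarrow> n \<noteq> 0 \<Longrightarrow> 1 - t_par b powi n \<noteq> 0"
  using hexp_neq_1[of "- of_int n * b"] by (simp add: t_par_def hexp_powi)

text \<open>For n > 0 the factor 1 - t^n of the current cancels the denominator in the normalisation
  of \<open>a_mode\<close> and leaves 1 - q^n, so no division remains.\<close>

lemma eta_coeff:
  assumes "b \<noteq> 0" "n \<noteq> 0"
  shows "boson_coeff b (eta_cur b i) i n =
    (if n < 0 then fls_const (- 1 / of_int n) * (1 - hexp (- of_int n * b))
     else fls_const (b\<^sup>2 / of_int n) * (1 - hexp (of_int n / b)))"
proof -
  have c: "fls_const (x / of_int n) = fls_const x / of_int n" for x :: complex
    by (simp only: fls_of_int fls_const_divide_const)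
  have t: "t_par b powi n = hexp (- of_int n * b)" and q: "q_par b powi n = hexp (of_int n / b)"
    by (simp_all add: t_par_def q_par_def hexp_powi)
  have nz: "1 - hexp (- of_int n * b) \<noteq> 0"
    using one_minus_t_powi[OF assms] by (simp only: t not_False_eq_True)
  have canc: "- D / N * (- B * C / D) = B / N * C" if "D \<noteq> 0" for B C D N :: hser
    using that by simp
  show ?thesis
    unfolding boson_coeff_def eta_cur_def t q c fls_const_uminus
    using assms canc[OF nz] by (auto simp: not_less)
qed

lemma eta_jet:
  assumes "b \<noteq> 0"
  shows "current_jet b (eta_cur b i) (\<lambda>j. if j = i then - b else 0)
    (\<lambda>j n. if j \<noteq> i then 0 else if n < 0 then b\<^sup>2 * of_int n / 2 else - of_int n / 2)"
  unfolding current_jet_def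
proof (intro allI impI)
  fix j and n :: int assume n: "n \<noteq> 0"
  show "jet (boson_coeff b (eta_cur b i) j n) 0 (if j = i then - b else 0)
    (if j \<noteq> i then 0 else if n < 0 then b\<^sup>2 * of_int n / 2 else - of_int n / 2)"
  proof (cases "j = i")
    case False
    then have "boson_coeff b (eta_cur b i) j n = 0" by (simp add: boson_coeff_def eta_cur_def)
    with False show ?thesis by (simp add: jet_0)
  next
    case True
    show ?thesis
    proof (cases "n < 0")
      case True
      have "jet (fls_const (- 1 / of_int n) * (1 - hexp (- of_int n * b))) 0 (- b) (b\<^sup>2 * of_int n / 2)"
        by (rule jet_cong, rule jet_const_mult[OF jet_diff[OF jet_1 jet_hexp]])
          (use n in \<open>simp_all add: field_simps power2_eq_square\<close>)
      with True \<open>j = i\<close> show ?thesis using eta_coeff[OF assms n] by simp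
    next
      case False
      have "jet (fls_const (b\<^sup>2 / of_int n) * (1 - hexp (of_int n / b))) 0 (- b) (- of_int n / 2)"
        by (rule jet_cong, rule jet_const_mult[OF jet_diff[OF jet_1 jet_hexp]])
          (use n assms in \<open>simp_all add: field_simps power2_eq_square\<close>)
      with False \<open>j = i\<close> show ?thesis using eta_coeff[OF assms n] by simp
    qed
  qed
qed

text \<open>Second-order coefficients of \<open>eta_cur\<close>. Creation modes come from t and
  annihilation modes from q, whence the two scales b^2 and 1.\<close>

definition zeta :: "complex \<Rightarrow> int \<Rightarrow> complex" where
  "zeta b n = (if n < 0 then b\<^sup>2 * of_int n / 2 else - of_int n / 2)"

lemma Lambda1_jet:
  assumes "b \<noteq> 0"
  shows "current_jet b (Lambda1_cur b) (\<lambda>j. if j = One then - b else 0)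
    (\<lambda>j n. if j = One then zeta b n else 0)"
  using eta_jet[OF assms, of One] unfolding Lambda1_cur_def
  by (rule current_jet_cong) (simp_all add: zeta_def)

text \<open>The extra creation term on the first boson is a product of two factors of order hbar, so
  it enters only at second order; the rest is a shifted \<open>eta_cur\<close>.\<close>

lemma Lambda2_jet:
  assumes "b \<noteq> 0"
  shows "current_jet b (Lambda2_cur b) (\<lambda>j. if j = Two then - b else 0)
    (\<lambda>j n. if j = One then (if n < 0 then b * Q_par b * of_int n else 0)
       else zeta b n - b * Q_par b * of_int n / 2)"
proof -
  define J :: current where "J = (\<lambda>j n. (if j = One \<and> n < 0
      then (1 - t_par b powi n) / of_int (- n) * (1 - t_par b powi (- n) * q_par b powi n) else 0))"
  have "current_jet b J (\<lambda>j. 0) (\<lambda>j n. if j = One \<and> n < 0 then b * Q_par b * of_int n else 0)"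
    unfolding current_jet_def
  proof (intro allI impI)
    fix j and n :: int assume n: "n \<noteq> 0"
    show "jet (boson_coeff b J j n) 0 0 (if j = One \<and> n < 0 then b * Q_par b * of_int n else 0)"
    proof (cases "j = One \<and> n < 0")
      case True
      have tq: "t_par b powi (- n) * q_par b powi n = hexp (of_int n * Q_par b)"
        unfolding t_par_def q_par_def hexp_powi hexp_add[symmetric] Q_par_def
        by (rule arg_cong[of _ _ hexp]) (simp add: algebra_simps)
      have J: "J j n = eta_cur b One One n * (1 - hexp (of_int n * Q_par b))"
        unfolding eta_cur_def J_def tq by (simp only: True if_True simp_thms if_False)
      have eq: "boson_coeff b J j n = boson_coeff b (eta_cur b One) One n * (1 - hexp (of_int n * Q_par b))"
        unfolding boson_coeff_def J by (simp only: mult_ac)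
      have "jet (boson_coeff b (eta_cur b One) One n) 0 (- b) (b\<^sup>2 * of_int n / 2)"
        using current_jetD[OF eta_jet[OF assms, of One] n, of One] True by simp
      from jet_mult[OF this jet_diff[OF jet_1 jet_hexp]]
      have "jet (boson_coeff b J j n) 0 0 (b * Q_par b * of_int n)"
        unfolding eq by (rule jet_cong) simp_all
      with True show ?thesis by simp
    next
      case False
      then have "J j n = 0" unfolding J_def by (simp only: if_False)
      with False show ?thesis by (auto simp: jet_0 boson_coeff_def)
    qed
  qed
  from current_jet_add[OF this current_jet_shift[OF eta_jet[OF assms, of Two], of "- (b + 1 / b) / 2"]]
  show ?thesis
    unfolding Lambda2_cur_def gamma_par_def J_def
  proof (rule current_jet_cong)
    fix i show "0 + (if i = Two then - b else 0) = (if i = Two then - b else 0)" by simp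
  next
    fix i and n :: int
    show "(if i = One \<and> n < 0 then b * Q_par b * of_int n else 0) +
       ((if i \<noteq> Two then 0 else if n < 0 then b\<^sup>2 * of_int n / 2 else - of_int n / 2)
        - (- (b + 1 / b) / 2) * of_int n * (if i = Two then - b else 0)) =
       (if i = One then (if n < 0 then b * Q_par b * of_int n else 0)
       else zeta b n - b * Q_par b * of_int n / 2)"
      by (cases i) (simp_all add: zeta_def Q_par_def algebra_simps)
  qed
qed

lemma X2_jet:
  assumes "b \<noteq> 0"
  shows "current_jet b (\<lambda>j m. Lambda1_cur b j m + shift_arg (q_par b / t_par b) (Lambda2_cur b) j m)
    (\<lambda>j. - b) (\<lambda>j n. (if j = One then zeta b n + (if n < 0 then b * Q_par b * of_int n else 0)
       else zeta b n + b * Q_par b * of_int n / 2))"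
  using current_jet_add[OF Lambda1_jet[OF assms] current_jet_shift[OF Lambda2_jet[OF assms], of "Q_par b"]]
  unfolding q_over_t
proof (rule current_jet_cong)
  fix i show "(if i = One then - b else 0) + (if i = Two then - b else 0) = - b"
    by (cases i) simp_all
next
  fix i and n :: int
  show "(if i = One then zeta b n else 0) +
     ((if i = One then if n < 0 then b * Q_par b * of_int n else 0
       else zeta b n - b * Q_par b * of_int n / 2)
      - Q_par b * of_int n * (if i = Two then - b else 0)) =
     (if i = One then zeta b n + (if n < 0 then b * Q_par b * of_int n else 0)
       else zeta b n + b * Q_par b * of_int n / 2)"
    by (cases i) simp_all
qed

text \<open>The denominator has constant term 2, which halves the leading coefficient. The
  second-order coefficients stay unspecified because they drop out of \<open>T_mode\<close> at order
  hbar^2.\<close>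

lemma bprime_jet:
  assumes "b \<noteq> 0"
  obtains d where "current_jet b (bprime_cur b) (\<lambda>j. if j = One then - b / 2 else b / 2) d"
proof -
  have "\<exists>d. jet (boson_coeff b (bprime_cur b) j n) 0 (if j = One then - b / 2 else b / 2) d"
    if n: "n \<noteq> 0" for j n
  proof -
    let ?e = "boson_coeff b (eta_cur b One) One n"
    let ?g = "if j = One then 1 else - hexp (Q_par b / 2 * of_int \<bar>n\<bar>)"
    have "bprime_cur b j n = eta_cur b One One n * inverse (1 + hexp (of_int \<bar>n\<bar> * Q_par b)) * ?g"
    proof -
      have q: "(q_par b / t_par b) powi \<bar>n\<bar> = hexp (of_int \<bar>n\<bar> * Q_par b)"
        by (simp only: q_over_t hexp_powi)
      have g: "gamma_par b powi (- \<bar>n\<bar>) = hexp (Q_par b / 2 * of_int \<bar>n\<bar>)"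
        unfolding gamma_par_def hexp_powi Q_par_def
        by (rule arg_cong[of _ _ hexp]) (simp add: field_simps)
      have m: "1 * X / Y * G / N = X / N * inverse Y * G"
        "- 1 * X / Y * G / N = - X / N * inverse Y * G" for X Y G N :: hser
        by (simp_all only: divide_inverse mult_1_left mult_1_right mult_minus_left mult_minus_right mult_ac)
      show ?thesis
      proof (cases "n < 0")
        case True
        show ?thesis
          unfolding bprime_cur_def eta_cur_def q g
          by (simp only: True if_True if_False m simp_thms abs_of_neg)
      next
        case False
        then have "\<bar>n\<bar> = n" by simp
        then show ?thesis
          unfolding bprime_cur_def eta_cur_def q g
          by (simp only: False if_False m simp_thms if_True)
      qed
    qed
    then have eq: "boson_coeff b (bprime_cur b) j n = ?e * inverse (1 + hexp (of_int \<bar>n\<bar> * Q_par b)) * ?g"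
      by (simp only: boson_coeff_def) (simp only: mult_ac)
    note e = current_jetD[OF eta_jet[OF assms, of One] n, of One]
    obtain i1 i2 where i: "jet (inverse (1 + hexp (of_int \<bar>n\<bar> * Q_par b))) (inverse (1 + 1)) i1 i2"
      by (rule jet_inverse[OF jet_add[OF jet_1 jet_hexp]]) simp_all
    have "\<exists>g1 g2. jet ?g (if j = One then 1 else - 1) g1 g2"
      using jet_1 jet_uminus[OF jet_hexp] by (cases j) (simp_all, blast+)
    then obtain g1 g2 where g: "jet ?g (if j = One then 1 else - 1) g1 g2" by blast
    show ?thesis
      unfolding eq
      by (rule exI, rule jet_cong[OF jet_mult[OF jet_mult[OF e i] g] _ _ refl]) simp_all
  qed
  then have "\<forall>j n. \<exists>d. n \<noteq> 0 \<longrightarrow>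
      jet (boson_coeff b (bprime_cur b) j n) 0 (if j = One then - b / 2 else b / 2) d" by blast
  then obtain d where "\<forall>j n. n \<noteq> 0 \<longrightarrow>
      jet (boson_coeff b (bprime_cur b) j n) 0 (if j = One then - b / 2 else b / 2) (d j n)"
    unfolding choice_iff by blast
  then show ?thesis
    by (intro that) (simp add: current_jet_def)
qed

section \<open>Expansion of the half exponentials\<close>

lemma weight_add_mset: "weight (add_mset p \<mu>) = Suc (snd p) + weight \<mu>"
  by (cases p) (simp add: weight_def)

lemma weight_diff: "p \<in># \<mu> \<Longrightarrow> weight \<mu> = Suc (snd p) + weight (\<mu> - {#p#})"
  by (metis insert_DiffM weight_add_mset)

text \<open>An operator of degree \<open>-n\<close> shifts the weight function \<open>g\<close> by \<open>n\<close>. Indicator functions \<open>g\<close> yield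
  that it preserves homogeneity, powers \<open>g w = x\<^sup>w\<close> that it rescales.\<close>

definition twist :: "(int \<Rightarrow> 'k::field) \<Rightarrow> 'k vec \<Rightarrow> 'k vec" where
  "twist g f = (\<lambda>\<mu>. g (int (weight \<mu>)) * f \<mu>)"

lemma twist_apply: "twist g f \<mu> = g (int (weight \<mu>)) * f \<mu>"
  by (simp add: twist_def)

lemma twist_pos: "twist (\<lambda>w. of_bool (w \<ge> 0)) f = f"
  by (simp add: twist_def)

lemma boson_twist: "boson c i n (twist g f) = twist (\<lambda>w. g (w + n)) (boson c i n f)"
proof
  fix \<mu> show "boson c i n (twist g f) \<mu> = twist (\<lambda>w. g (w + n)) (boson c i n f) \<mu>"
    using weight_diff[of "(i, nat \<bar>n\<bar> - 1)" \<mu>] weight_add_mset[of "(i, nat \<bar>n\<bar> - 1)" \<mu>]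
    by (auto simp: boson_def twist_apply Let_def algebra_simps)
qed

lemma a_mode_twist: "a_mode b i n (twist g f) = twist (\<lambda>w. g (w + n)) (a_mode b i n f)"
  by (rule ext) (simp add: a_mode_def boson_twist twist_apply mult_ac)

lemma half_pow_twist:
  "half_pow b s J k N (twist g f) = twist (\<lambda>w. g (w + s * int N)) (half_pow b s J k N f)"
proof (induction k arbitrary: N)
  case 0
  show ?case by (auto simp: twist_apply)
next
  case (Suc k)
  have *: "a_mode b i (s * int n) (half_pow b s J k (N - n) (twist g f)) \<mu>
      = g (int (weight \<mu>) + s * int N) * a_mode b i (s * int n) (half_pow b s J k (N - n) f) \<mu>"
    if "n \<in> {1..N}" for n i \<mu>
    using that unfolding Suc a_mode_twist twist_apply by (simp add: of_nat_diff algebra_simps)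
  show ?case
  proof
    fix \<mu>
    show "half_pow b s J (Suc k) N (twist g f) \<mu>
        = twist (\<lambda>w. g (w + s * int N)) (half_pow b s J (Suc k) N f) \<mu>"
      unfolding half_pow.simps twist_apply[of "\<lambda>w. g (w + s * int N)"] sum_distrib_left
      by (intro sum.cong refl) (simp only: * mult.left_commute)
  qed
qed

lemma half_exp_twist:
  "half_exp b s J N (twist g f) = twist (\<lambda>w. g (w + s * int N)) (half_exp b s J N f)"
  by (rule ext) (simp add: half_exp_def half_pow_twist twist_apply sum_distrib_left)

lemma nexp_twist: "nexp b J n (twist g f) = twist (\<lambda>w. g (w + n)) (nexp b J n f)"
proof
  fix \<mu>
  have "half_exp b (- 1) J r (half_exp b 1 J (nat (int r + n)) (twist g f)) \<mu>
      = g (int (weight \<mu>) + n) * half_exp b (- 1) J r (half_exp b 1 J (nat (int r + n)) f) \<mu>"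
    if "int r + n \<ge> 0" for r
    using that by (simp add: half_exp_twist twist_apply)
  then show "nexp b J n (twist g f) \<mu> = twist (\<lambda>w. g (w + n)) (nexp b J n f) \<mu>"
    unfolding twist_apply nexp_def sum_distrib_left by (intro sum.cong) auto
qed

lemma X_mode_twist: "X_mode b w i n (twist g f) = twist (\<lambda>w. g (w + n)) (X_mode b w i n f)"
  by (rule ext) (simp add: X_mode_def nexp_twist twist_apply algebra_simps)

lemma T_mode_twist: "T_mode b w n (twist g f) = twist (\<lambda>w. g (w + n)) (T_mode b w n f)"
  by (rule ext) (simp add: T_mode_def nexp_twist twist_apply algebra_simps)

definition lin :: "complex \<Rightarrow> (idx \<Rightarrow> int \<Rightarrow> complex) \<Rightarrow> int \<Rightarrow> complex vec \<Rightarrow> complex vec" where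
  "lin b c n f = (\<lambda>\<mu>. \<Sum>i\<in>{One, Two}. c i n * boson (- 1 / b\<^sup>2) i n f \<mu>)"

lemma lin_twist: "lin b c n (twist g f) = twist (\<lambda>w. g (w + n)) (lin b c n f)"
  by (rule ext) (simp add: lin_def boson_twist twist_apply algebra_simps)

text \<open>The convention that mode 0 acts by zero lets later mode sums include an index 0 without
  correction.\<close>

lemma boson_0_mode [simp]: "boson c i 0 f = (\<lambda>_. 0)"
  and boson_0_vec [simp]: "boson c i n (\<lambda>_. 0) = (\<lambda>_. 0)"
  by (auto simp: boson_def Let_def)

lemma lin_0_mode [simp]: "lin b c 0 f = (\<lambda>_. 0)"
  and lin_0_vec [simp]: "lin b c n (\<lambda>_. 0) = (\<lambda>_. 0)"
  by (auto simp: lin_def)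

text \<open>Weights are nonnegative, so twisting by the indicator of w >= 0 changes nothing; moving
  it past the operator produces a vanishing factor.\<close>

lemma lin_vanish: "int (weight \<mu>) + n < 0 \<Longrightarrow> lin b c n f \<mu> = 0"
  using lin_twist[of b c n "\<lambda>w. of_bool (w \<ge> 0)" f, THEN fun_cong, of \<mu>]
  by (simp add: twist_pos twist_apply)

lemma lin_lin_vanish: "int (weight \<mu>) + n + m < 0 \<Longrightarrow> lin b c n (lin b c' m f) \<mu> = 0"
  using lin_twist[of b c' m "\<lambda>w. of_bool (w \<ge> 0)" f]
    lin_twist[of b c n "\<lambda>w. of_bool (w + m \<ge> 0)" "lin b c' m f", THEN fun_cong, of \<mu>]
  by (simp add: twist_pos twist_apply)

section \<open>Powers of a current up to order hbar^2\<close>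

definition vjet :: "hser vec \<Rightarrow> complex vec \<Rightarrow> complex vec \<Rightarrow> complex vec \<Rightarrow> bool" where
  "vjet f f0 f1 f2 \<longleftrightarrow> (\<forall>\<mu>. jet (f \<mu>) (f0 \<mu>) (f1 \<mu>) (f2 \<mu>))"

lemma boson_jet:
  assumes "vjet f f0 f1 f2"
  shows "vjet (boson (fls_const c) i n f) (boson c i n f0) (boson c i n f1) (boson c i n f2)"
proof -
  have "jet (fls_const c * of_int n * of_nat k * x) (c * of_int n * of_nat k * x0)
      (c * of_int n * of_nat k * x1) (c * of_int n * of_nat k * x2)" if "jet x x0 x1 x2" for k x x0 x1 x2
    using jet_const_mult[OF that, of "c * of_int n * of_nat k"] by (simp add: fls_of_int fls_of_nat)
  with assms show ?thesis
    unfolding vjet_def boson_def Let_def by (auto simp only: jet_0 split: if_split)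
qed

definition current_mode :: "complex \<Rightarrow> current \<Rightarrow> int \<Rightarrow> hser vec \<Rightarrow> hser vec" where
  "current_mode b J n f = (\<lambda>\<mu>. \<Sum>i\<in>{One, Two}. J i n * a_mode b i n f \<mu>)"

lemma current_mode_eq:
  "current_mode b J n f = (\<lambda>\<mu>. \<Sum>i\<in>{One, Two}. boson_coeff b J i n * boson (fls_const (- 1 / b\<^sup>2)) i n f \<mu>)"
  by (simp add: current_mode_def a_mode_def boson_coeff_def mult_ac)

lemma current_mode_jet:
  assumes "current_jet b J c d" "vjet f f0 f1 f2"
  shows "vjet (current_mode b J n f) (\<lambda>_. 0) (lin b (\<lambda>i _. c i) n f0)
    (\<lambda>\<mu>. lin b (\<lambda>i _. c i) n f1 \<mu> + lin b d n f0 \<mu>)"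
proof (cases "n = 0")
  case True
  then show ?thesis by (simp add: current_mode_eq vjet_def jet_0)
next
  case False
  note B = boson_jet[OF assms(2), unfolded vjet_def, rule_format]
  note J = current_jetD[OF assms(1) False]
  show ?thesis
    unfolding vjet_def current_mode_eq lin_def sum.distrib[symmetric]
    by (intro allI jet_cong[OF jet_sum[OF jet_mult[OF J B]] _ _ refl] jet_cong[OF jet_sum[OF jet_mult[OF J B]]])
      simp_all
qed

lemma half_pow_Suc: "half_pow b s J (Suc k) N f =
    (\<lambda>\<mu>. \<Sum>n\<in>{1..N}. current_mode b J (s * int n) (half_pow b s J k (N - n) f) \<mu>)"
  by (simp add: current_mode_def)

text \<open>Each factor uses up at least one unit of the order \<open>N\<close>. This is why cutting
  the exponential series at \<open>N\<close> in \<open>half_exp\<close> is exact.\<close>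

lemma half_pow_eq_0: "k > N \<Longrightarrow> half_pow b s J k N f = (\<lambda>_. 0)"
proof (induction k arbitrary: N)
  case (Suc k)
  have "half_pow b s J k (N - n) f = (\<lambda>_. 0)" if "n \<in> {1..N}" for n
    using that Suc by auto
  then show ?case
    unfolding half_pow_Suc by (intro ext sum.neutral) (simp add: current_mode_eq)
qed simp

lemma vjet_sum:
  assumes "\<And>i. i \<in> A \<Longrightarrow> vjet (f i) (f0 i) (f1 i) (f2 i)"
  shows "vjet (\<lambda>\<mu>. \<Sum>i\<in>A. f i \<mu>) (\<lambda>\<mu>. \<Sum>i\<in>A. f0 i \<mu>) (\<lambda>\<mu>. \<Sum>i\<in>A. f1 i \<mu>) (\<lambda>\<mu>. \<Sum>i\<in>A. f2 i \<mu>)"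
  using assms by (simp add: vjet_def jet_sum)

lemma lin_if: "lin b c n (\<lambda>\<mu>. if P then f \<mu> else 0) = (\<lambda>\<mu>. if P then lin b c n f \<mu> else 0)"
  by (cases P) simp_all

text \<open>A current is of order hbar, so its k-th power is of order hbar^k and only k = 0, 1, 2
  are visible.\<close>

lemma half_pow_jet:
  assumes J: "current_jet b J c d" and f: "vjet f f0 f1 f2"
  defines "L \<equiv> lin b (\<lambda>i _. c i)"
  shows half_pow_jet_0: "vjet (half_pow b s J 0 N f) (\<lambda>\<mu>. if N = 0 then f0 \<mu> else 0)
      (\<lambda>\<mu>. if N = 0 then f1 \<mu> else 0) (\<lambda>\<mu>. if N = 0 then f2 \<mu> else 0)"
    and half_pow_jet_1: "vjet (half_pow b s J 1 N f) (\<lambda>_. 0) (L (s * int N) f0)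
      (\<lambda>\<mu>. L (s * int N) f1 \<mu> + lin b d (s * int N) f0 \<mu>)"
    and half_pow_jet_2: "vjet (half_pow b s J 2 N f) (\<lambda>_. 0) (\<lambda>_. 0)
      (\<lambda>\<mu>. \<Sum>k\<in>{1..N}. L (s * int k) (L (s * int (N - k)) f0) \<mu>)"
    and half_pow_jet_ge_3: "vjet (half_pow b s J (3 + k) N f) (\<lambda>_. 0) (\<lambda>_. 0) (\<lambda>_. 0)"
proof -
  show 0: "vjet (half_pow b s J 0 N f) (\<lambda>\<mu>. if N = 0 then f0 \<mu> else 0)
      (\<lambda>\<mu>. if N = 0 then f1 \<mu> else 0) (\<lambda>\<mu>. if N = 0 then f2 \<mu> else 0)" for N
    using f by (simp add: vjet_def jet_0)
  show 1: "vjet (half_pow b s J 1 N f) (\<lambda>_. 0) (L (s * int N) f0)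
      (\<lambda>\<mu>. L (s * int N) f1 \<mu> + lin b d (s * int N) f0 \<mu>)" for N
  proof -
    \<comment> \<open>The zeroth power lives at order 0, so the recursion for the first power keeps
      only the summand n = N; for N = 0 the sum is empty.\<close>
    have top: "(\<Sum>n\<in>{1..N}. if N - n = 0 then g n else 0) = (if N = 0 then 0 else g N)" for g :: "nat \<Rightarrow> complex"
    proof -
      have "(\<Sum>n\<in>{1..N}. if N - n = 0 then g n else 0) = (\<Sum>n\<in>{1..N}. if n = N then g N else 0)"
        by (intro sum.cong) auto
      then show ?thesis by simp
    qed
    have L_if: "L n (\<lambda>\<mu>. if P then f \<mu> else 0) = (\<lambda>\<mu>. if P then L n f \<mu> else 0)" for n P f
      unfolding L_def by (rule lin_if)
    have z: "L (s * int N) f0 = (\<lambda>_. 0)" "L (s * int N) f1 = (\<lambda>_. 0)" "lin b d (s * int N) f0 = (\<lambda>_. 0)" if "N = 0"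
      using that by (simp_all add: L_def)
    have "half_pow b s J 1 N f = (\<lambda>\<mu>. \<Sum>n\<in>{1..N}. current_mode b J (s * int n) (half_pow b s J 0 (N - n) f) \<mu>)"
      unfolding One_nat_def half_pow_Suc ..
    moreover have "vjet (\<lambda>\<mu>. \<Sum>n\<in>{1..N}. current_mode b J (s * int n) (half_pow b s J 0 (N - n) f) \<mu>)
       (\<lambda>_. 0) (L (s * int N) f0) (\<lambda>\<mu>. L (s * int N) f1 \<mu> + lin b d (s * int N) f0 \<mu>)"
      using vjet_sum[of "{1..N}" "\<lambda>n. current_mode b J (s * int n) (half_pow b s J 0 (N - n) f)", OF current_mode_jet[OF J 0]]
      unfolding L_def[symmetric]
      unfolding L_if lin_if sum.distrib top
      using z by (cases "N = 0") auto
    ultimately show ?thesis by simp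
  qed
  show 2: "vjet (half_pow b s J 2 N f) (\<lambda>_. 0) (\<lambda>_. 0)
      (\<lambda>\<mu>. \<Sum>k\<in>{1..N}. L (s * int k) (L (s * int (N - k)) f0) \<mu>)" for N
    using vjet_sum[of "{1..N}" "\<lambda>n. current_mode b J (s * int n) (half_pow b s J 1 (N - n) f)", OF current_mode_jet[OF J 1]]
    unfolding Suc_1[symmetric] half_pow_Suc[of b s J 1] L_def[symmetric]
    by (simp add: L_def del: half_pow.simps One_nat_def)
  show "vjet (half_pow b s J (3 + k) N f) (\<lambda>_. 0) (\<lambda>_. 0) (\<lambda>_. 0)"
  proof (induction k arbitrary: N)
    case 0
    have three: "(3 + 0 :: nat) = Suc 2" by simp
    show ?case
      using vjet_sum[of "{1..N}" "\<lambda>n. current_mode b J (s * int n) (half_pow b s J 2 (N - n) f)", OF current_mode_jet[OF J 2]]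
      unfolding three half_pow_Suc[of b s J 2] by simp
  next
    case (Suc k)
    show ?case
      using vjet_sum[of "{1..N}" "\<lambda>n. current_mode b J (s * int n) (half_pow b s J (3 + k) (N - n) f)", OF current_mode_jet[OF J Suc.IH]]
      unfolding add_Suc_right half_pow_Suc by simp
  qed
qed

lemma half_exp_jet:
  assumes J: "current_jet b J c d" and f: "vjet f f0 f1 f2"
  defines "L \<equiv> lin b (\<lambda>i _. c i)"
  shows "vjet (half_exp b s J N f) (\<lambda>\<mu>. if N = 0 then f0 \<mu> else 0)
    (\<lambda>\<mu>. (if N = 0 then f1 \<mu> else 0) + L (s * int N) f0 \<mu>)
    (\<lambda>\<mu>. (if N = 0 then f2 \<mu> else 0) + (L (s * int N) f1 \<mu> + lin b d (s * int N) f0 \<mu>)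
      + (\<Sum>k\<in>{1..N}. L (s * int k) (L (s * int (N - k)) f0) \<mu>) / 2)"
proof -
  note P = half_pow_jet[OF J f, of s]
  have "half_exp b s J N f \<mu> = half_pow b s J 0 N f \<mu> + half_pow b s J 1 N f \<mu>
      + fls_const (1 / 2) * half_pow b s J 2 N f \<mu> + (\<Sum>k\<in>{3..N + 2}. fls_const (1 / fact k) * half_pow b s J k N f \<mu>)" for \<mu>
  proof -
    have c: "x / fact k = fls_const (1 / fact k) * x" for k and x :: hser
    proof -
      have "(fact k :: hser) = fls_const (fact k)"
        using fls_of_nat[of "fact k", where ?'a = complex] by (simp only: of_nat_fact)
      then show ?thesis
        by (simp add: fls_const_divide_const[symmetric])
    qed
    \<comment> \<open>The sum is padded up to N + 2 with vanishing powers, so that k = 0, 1, 2 can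
      be split off also when N < 2.\<close>
    have "half_exp b s J N f \<mu> = (\<Sum>k\<in>{0..N + 2}. fls_const (1 / fact k) * half_pow b s J k N f \<mu>)"
      unfolding half_exp_def c
      by (rule sum.mono_neutral_left) (auto simp: half_pow_eq_0)
    also have "\<dots> = (\<Sum>k\<in>{0..2}. fls_const (1 / fact k) * half_pow b s J k N f \<mu>)
        + (\<Sum>k\<in>{3..N + 2}. fls_const (1 / fact k) * half_pow b s J k N f \<mu>)"
    proof -
      have "{0..N + 2} = {0..2} \<union> {3..N + 2}" by auto
      then show ?thesis by (simp only:) (rule sum.union_disjoint, auto)
    qed
    also have "(\<Sum>k\<in>{0..2}. fls_const (1 / fact k) * half_pow b s J k N f \<mu>) =
       half_pow b s J 0 N f \<mu> + half_pow b s J 1 N f \<mu> + fls_const (1 / 2) * half_pow b s J 2 N f \<mu>"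
      unfolding numeral_2_eq_2 by (simp add: sum.atLeast0_atMost_Suc del: half_pow.simps)
    finally show ?thesis .
  qed
  moreover have "jet (\<Sum>k\<in>{3..N + 2}. fls_const (1 / fact k) * half_pow b s J k N f \<mu>) (\<Sum>k\<in>{3..N + 2}. 0) (\<Sum>k\<in>{3..N + 2}. 0) (\<Sum>k\<in>{3..N + 2}. 0)" for \<mu>
  proof (rule jet_sum)
    fix k assume "k \<in> {3..N + 2}"
    then obtain l where "k = 3 + l" by (auto simp: le_iff_add)
    then show "jet (fls_const (1 / fact k) * half_pow b s J k N f \<mu>) 0 0 0"
      using jet_const_mult[OF P(4)[unfolded vjet_def, rule_format], of "1 / fact k" l N \<mu>] by simp
  qed
  moreover note jet_add[OF jet_add[OF jet_add[OF P(1)[of N, unfolded vjet_def, rule_format]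
    P(2)[of N, unfolded vjet_def, rule_format]] jet_const_mult[OF P(3)[of N, unfolded vjet_def, rule_format], of "1 / 2"]]]
  ultimately have "jet (half_exp b s J N f \<mu>)
     ((if N = 0 then f0 \<mu> else 0) + 0 + 1 / 2 * 0 + (\<Sum>k\<in>{3..N + 2}. 0))
     ((if N = 0 then f1 \<mu> else 0) + L (s * int N) f0 \<mu> + 1 / 2 * 0 + (\<Sum>k\<in>{3..N + 2}. 0))
     ((if N = 0 then f2 \<mu> else 0) + (L (s * int N) f1 \<mu> + lin b d (s * int N) f0 \<mu>)
      + 1 / 2 * (\<Sum>k\<in>{1..N}. L (s * int k) (L (s * int (N - k)) f0) \<mu>) + (\<Sum>k\<in>{3..N + 2}. 0))" for \<mu>
    unfolding L_def by (simp only:)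
  then show ?thesis
    unfolding vjet_def by (simp add: field_simps)
qed

section \<open>Expansion of normal ordered exponentials\<close>

lemma boson_add: "boson c i n (\<lambda>\<mu>. f \<mu> + g \<mu>) = (\<lambda>\<mu>. boson c i n f \<mu> + boson c i n g \<mu>)"
  by (rule ext) (simp add: boson_def Let_def algebra_simps)

lemma boson_scale: "boson c i n (\<lambda>\<mu>. a * f \<mu>) = (\<lambda>\<mu>. a * boson c i n f \<mu>)"
  by (rule ext) (simp add: boson_def Let_def algebra_simps)

lemma lin_add: "lin b c n (\<lambda>\<mu>. f \<mu> + g \<mu>) = (\<lambda>\<mu>. lin b c n f \<mu> + lin b c n g \<mu>)"
  by (rule ext) (simp add: lin_def boson_add algebra_simps)

text \<open>\<open>qsum M n F\<close> sums \<open>F k\<close> over the products \<open>:A\<^sub>k A\<^bsub>n-k\<^esub>:\<close> in a normal ordered square, grouped as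
  both factors annihilating, both creating (or zero modes), and mixed; the last group is cut off at \<open>k \<ge> -M\<close>.\<close>

definition qsum :: "int \<Rightarrow> int \<Rightarrow> (int \<Rightarrow> complex) \<Rightarrow> complex" where
  "qsum M n F = sum F {0<..<n} + sum F {n..0} + 2 * sum F {- M..min 0 (n - 1)}"

lemma qsum_add: "qsum M n (\<lambda>k. F k + G k) = qsum M n F + qsum M n G"
  by (simp add: qsum_def sum.distrib algebra_simps)

lemma qsum_scale: "qsum M n (\<lambda>k. a * F k) = a * qsum M n F"
  by (simp add: qsum_def sum_distrib_left algebra_simps)

lemma qsum_diff: "qsum M n (\<lambda>k. F k - G k) = qsum M n F - qsum M n G"
  by (simp add: qsum_def sum_subtractf algebra_simps)

lemma qsum_sum: "qsum M n (\<lambda>k. \<Sum>i\<in>A. F i k) = (\<Sum>i\<in>A. qsum M n (F i))"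
  by (simp add: qsum_def sum.distrib sum_distrib_left sum.swap[of _ A])

text \<open>At order hbar^2 at most two modes act. Two from the same half carry the 1/2 of the
  exponential series, one from each half carries 1; halving \<open>qsum\<close>, which doubles mixed
  products, covers both.\<close>

lemma nexp_jet:
  assumes J: "current_jet b J c d" and f: "vjet f f0 f1 f2" and M: "int (weight \<mu>) \<le> M"
  defines "L \<equiv> lin b (\<lambda>i _. c i)"
  shows "jet (nexp b J n f \<mu>) (if n = 0 then f0 \<mu> else 0)
    ((if n = 0 then f1 \<mu> else 0) + L n f0 \<mu>)
    ((if n = 0 then f2 \<mu> else 0) + L n f1 \<mu> + lin b d n f0 \<mu> + qsum M n (\<lambda>k. L k (L (n - k) f0) \<mu>) / 2)"
proof -
  let ?w = "weight \<mu>"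
  let ?N = "\<lambda>r. nat (int r + n)"
  let ?D = "lin b d"
  let ?LL = "\<lambda>k. L k (L (n - k) f0) \<mu>"
  have L_if: "L n (\<lambda>\<mu>. if P then f \<mu> else 0) = (\<lambda>\<mu>. if P then L n f \<mu> else 0)" for n P f
    unfolding L_def by (rule lin_if)
  have L_add: "L n (\<lambda>\<mu>. f \<mu> + g \<mu>) = (\<lambda>\<mu>. L n f \<mu> + L n g \<mu>)" for n f g
    unfolding L_def by (rule lin_add)
  have L_0: "L 0 f = (\<lambda>_. 0)" "L n (\<lambda>_. 0) = (\<lambda>_. 0)" for f n
    by (simp_all add: L_def)
  define t0 where "t0 r = (if r = 0 then if ?N r = 0 then f0 \<mu> else 0 else 0)" for r :: nat
  define A1 where "A1 m = (if m = 0 then f1 \<mu> else 0) + L (int m) f0 \<mu>" for m :: nat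
  define t1 where "t1 r = (if r = 0 then A1 (?N r) else 0)
      + (if ?N r = 0 then L (- int r) f0 \<mu> else 0)" for r :: nat
  define A where "A m = (if m = 0 then f2 \<mu> else 0) + (L (int m) f1 \<mu> + ?D (int m) f0 \<mu>)
      + (\<Sum>k\<in>{1..m}. L (int k) (L (int (m - k)) f0) \<mu>) / 2" for m
  define B where "B r = L (- int r) f1 \<mu> + ?D (- int r) f0 \<mu>
      + (\<Sum>k\<in>{1..r}. L (- int k) (L (- int (r - k)) f0) \<mu>) / 2" for r
  define t2 where "t2 r = (if r = 0 then A (?N r) else 0) + (if ?N r = 0 then B r else 0)
      + L (- int r) (L (?N r) f0) \<mu>" for r :: nat
  have summand: "jet (half_exp b (- 1) J r (half_exp b 1 J (?N r) f) \<mu>) (t0 r) (t1 r) (t2 r)" for r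
    using half_exp_jet[OF J half_exp_jet[OF J f, of 1 "?N r"], of "- 1" r,
        unfolded vjet_def L_def[symmetric], rule_format, of \<mu>]
    unfolding t0_def t1_def t2_def A_def A1_def B_def L_add L_if lin_if
    by (elim jet_cong) (auto simp: L_0 sum.distrib algebra_simps)
  have "jet (nexp b J n f \<mu>) (\<Sum>r\<le>?w. if int r + n \<ge> 0 then t0 r else 0)
     (\<Sum>r\<le>?w. if int r + n \<ge> 0 then t1 r else 0) (\<Sum>r\<le>?w. if int r + n \<ge> 0 then t2 r else 0)"
    unfolding nexp_def by (rule jet_sum) (simp add: summand jet_0)
  \<comment> \<open>Terms with the condition r = 0 come from the annihilation half alone;
    \<open>last\<close> collapses those with r + n = 0, where only the creation half acts.\<close>
  moreover have first: "(\<Sum>r\<le>?w. if int r + n \<ge> 0 then if r = 0 then h (?N r) else 0 else 0)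
      = (if n \<ge> 0 then h (nat n) else 0)" for h :: "nat \<Rightarrow> complex"
  proof -
    have "(\<Sum>r\<le>?w. if int r + n \<ge> 0 then if r = 0 then h (?N r) else 0 else 0)
      = (\<Sum>r\<le>?w. if r = 0 then if n \<ge> 0 then h (nat n) else 0 else 0)"
      by (intro sum.cong) auto
    then show ?thesis by simp
  qed
  moreover have last: "(\<Sum>r\<le>?w. if int r + n \<ge> 0 then if ?N r = 0 then h r else 0 else 0)
      = (if n \<le> 0 \<and> - n \<le> ?w then h (nat (- n)) else 0)" for h :: "nat \<Rightarrow> complex"
  proof -
    have "(\<Sum>r\<le>?w. if int r + n \<ge> 0 then if ?N r = 0 then h r else 0 else 0)
      = (\<Sum>r\<le>?w. if r = nat (- n) then if n \<le> 0 then h (nat (- n)) else 0 else 0)"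
      by (intro sum.cong) auto
    then show ?thesis by auto
  qed
  have split: "(if P then x + y else 0) = (if P then x else 0) + (if P then y else (0::complex))" for P x y
    by simp
  have van: "L m g \<mu> = 0" "?D m g \<mu> = 0" if "int ?w + m < 0" for m g
    using that unfolding L_def by (simp_all add: lin_vanish)
  have S0: "(\<Sum>r\<le>?w. if int r + n \<ge> 0 then t0 r else 0) = (if n = 0 then f0 \<mu> else 0)"
    unfolding t0_def first[of "\<lambda>m. if m = 0 then f0 \<mu> else 0"] by auto
  have S1: "(\<Sum>r\<le>?w. if int r + n \<ge> 0 then t1 r else 0) = (if n = 0 then f1 \<mu> else 0) + L n f0 \<mu>"
    unfolding t1_def split sum.distrib last first[of A1]
    using van(1)[of n f0] L_0 by (cases "n > 0"; cases "n = 0") (auto simp: A1_def)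
  \<comment> \<open>Here k = -r. The index r = -n may be dropped since its inner mode is 0, and k
    may run below minus the weight, where the outer creation mode gives 0 at
    \<open>\<mu>\<close>.\<close>
  have mixed: "(\<Sum>r\<le>?w. if int r + n \<ge> 0 then L (- int r) (L (?N r) f0) \<mu> else 0)
      = sum ?LL {- M..min 0 (n - 1)}"
    unfolding sum.inter_filter[OF finite_atMost, symmetric]
  proof (rule sum.reindex_bij_witness_not_neutral
      [where i = "\<lambda>k. nat (- k)" and j = "\<lambda>r. - int r"
         and S' = "{r. r \<le> ?w \<and> int r + n = 0}" and T' = "{- M..< - int ?w}"])
    show "finite {r. r \<le> ?w \<and> int r + n = 0}" by simp
    show "L (- int r) (L (?N r) f0) \<mu> = 0" if "r \<in> {r. r \<le> ?w \<and> int r + n = 0}" for r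
      using that by (auto simp: L_0)
    show "?LL k = 0" if "k \<in> {- M..< - int ?w}" for k
      using that by (auto intro!: van)
  qed (use M in \<open>auto simp: add.commute\<close>)
  have upper: "(if n \<ge> 0 then \<Sum>k\<in>{1..nat n}. L (int k) (L (int (nat n - k)) f0) \<mu> else 0) = sum ?LL {0<..<n}"
  proof (cases "n \<ge> 0")
    case True
    have "(\<Sum>k\<in>{1..nat n}. L (int k) (L (int (nat n - k)) f0) \<mu>) = sum ?LL {0<..<n}"
      by (rule sum.reindex_bij_witness_not_neutral
          [where i = nat and j = int and S' = "{nat n}" and T' = "{}"])
        (use True in \<open>auto simp: L_0 of_nat_diff\<close>)
    with True show ?thesis by simp
  qed simp
  have lower: "(if n \<le> 0 \<and> - n \<le> ?w then \<Sum>k\<in>{1..nat (- n)}. L (- int k) (L (- int (nat (- n) - k)) f0) \<mu> else 0)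
      = sum ?LL {n..0}"
  proof (cases "n \<le> 0 \<and> - n \<le> ?w")
    case True
    have "(\<Sum>k\<in>{1..nat (- n)}. L (- int k) (L (- int (nat (- n) - k)) f0) \<mu>) = sum ?LL {n..0}"
      by (rule sum.reindex_bij_witness_not_neutral
          [where i = "\<lambda>k. nat (- k)" and j = "\<lambda>k. - int k" and S' = "{}" and T' = "{0}"])
        (use True in \<open>auto simp: L_0 of_nat_diff add.commute\<close>)
    with True show ?thesis by simp
  next
    case False
    \<comment> \<open>When -n exceeds the weight, the product raises the weight too far to be seen
      at \<open>\<mu>\<close>.\<close>
    then have "?LL k = 0" if "k \<in> {n..0}" for k
      using that unfolding L_def by (intro lin_lin_vanish) auto
    then have "sum ?LL {n..0} = 0" by (intro sum.neutral) blast
    with False show ?thesis by (simp only: if_False)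
  qed
  have S2: "(\<Sum>r\<le>?w. if int r + n \<ge> 0 then t2 r else 0)
    = (if n = 0 then f2 \<mu> else 0) + L n f1 \<mu> + ?D n f0 \<mu> + qsum M n ?LL / 2"
  proof -
    have "(\<Sum>r\<le>?w. if int r + n \<ge> 0 then t2 r else 0)
      = (if n \<ge> 0 then A (nat n) else 0) + (if n \<le> 0 \<and> - n \<le> ?w then B (nat (- n)) else 0)
        + sum ?LL {- M..min 0 (n - 1)}"
      unfolding t2_def split sum.distrib last first[of A] mixed ..
    also have "(if n \<ge> 0 then A (nat n) else 0) = (if n = 0 then f2 \<mu> else 0)
        + (if n > 0 then L n f1 \<mu> + ?D n f0 \<mu> else 0) + sum ?LL {0<..<n} / 2"
      unfolding upper[symmetric] A_def by (auto simp: L_0)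
    also have "(if n \<le> 0 \<and> - n \<le> ?w then B (nat (- n)) else 0)
        = (if n > 0 then 0 else L n f1 \<mu> + ?D n f0 \<mu>) + sum ?LL {n..0} / 2"
      unfolding lower[symmetric] B_def using van[of n] by auto
    also note eq = calculation
    have arith: "d + p + a' / 2 + (q + b' / 2) + c' = d + x + y + (a' + b' + 2 * c') / 2"
      if "p + q = x + y" for d p q x y a' b' c' :: complex
    proof -
      have "d + p + a' / 2 + (q + b' / 2) + c' = d + (p + q) + (a' + b' + 2 * c') / 2"
        by (simp add: field_simps)
      then show ?thesis by (simp add: that)
    qed
    show ?thesis
      unfolding eq qsum_def by (rule arith) auto
  qed
  ultimately show ?thesis
    unfolding S0 S1 S2 by simp
qed

section \<open>The operators X and L\<close>

text \<open>This is -2 sqrt(-1) times \<open>beta2\<close>: in this normalisation it is the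
  order-hbar coefficient of both X^(1) and X^(2) on vectors independent of hbar.\<close>

definition phi :: "complex \<Rightarrow> (idx \<Rightarrow> complex) \<Rightarrow> int \<Rightarrow> complex vec \<Rightarrow> complex vec" where
  "phi b w n f = (\<lambda>\<mu>. - b * (boson (- 1 / b\<^sup>2) One n f \<mu> + boson (- 1 / b\<^sup>2) Two n f \<mu>)
     + (if n = 0 then (w One + w Two) * f \<mu> else 0))"

lemma beta2_phi: "beta2 b w n f = (\<lambda>\<mu>. \<i> / 2 * phi b w n f \<mu>)"
  by (rule ext) (simp add: beta2_def phi_def algebra_simps)

text \<open>For i = j this is a mode of the normal ordered square. For distinct i, j the doubled
  mixed terms are one-sided, and only the sum over both orders is (twice) the normal ordered
  product.\<close>

definition bquad :: "complex \<Rightarrow> idx \<Rightarrow> idx \<Rightarrow> int \<Rightarrow> int \<Rightarrow> complex vec \<Rightarrow> mono \<Rightarrow> complex" where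
  "bquad b i j M n f \<mu> = qsum M n (\<lambda>k. boson (- 1 / b\<^sup>2) i k (boson (- 1 / b\<^sup>2) j (n - k) f) \<mu>)"

lemma lin_eq: "lin b c n f \<mu> = c One n * boson (- 1 / b\<^sup>2) One n f \<mu> + c Two n * boson (- 1 / b\<^sup>2) Two n f \<mu>"
  by (simp add: lin_def)

lemma qsum_lin:
  "qsum M n (\<lambda>k. lin b (\<lambda>i _. c i) k (lin b (\<lambda>i _. c i) (n - k) f) \<mu>) =
     (c One)\<^sup>2 * bquad b One One M n f \<mu> + c One * c Two * bquad b One Two M n f \<mu>
     + c Two * c One * bquad b Two One M n f \<mu> + (c Two)\<^sup>2 * bquad b Two Two M n f \<mu>"
  unfolding bquad_def qsum_scale[symmetric] qsum_add[symmetric]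
  by (rule arg_cong[of _ _ "qsum M n"], rule ext)
    (simp add: lin_def boson_add boson_scale power2_eq_square algebra_simps)

lemma lin_scale: "lin b c n (\<lambda>\<mu>. a * f \<mu>) = (\<lambda>\<mu>. a * lin b c n f \<mu>)"
  by (rule ext) (simp add: lin_def boson_scale algebra_simps)

lemma phi_eq_lin: "phi b w n f = (\<lambda>\<mu>. lin b (\<lambda>_ _. - b) n f \<mu> + (if n = 0 then (w One + w Two) * f \<mu> else 0))"
  by (rule ext) (simp add: phi_def lin_def algebra_simps)

lemma qsum_delta:
  "qsum M n (\<lambda>k. if k = a then x else 0) =
    ((if 0 < a \<and> a < n then 1 else 0) + (if n \<le> a \<and> a \<le> 0 then 1 else 0)
      + (if - M \<le> a \<and> a \<le> 0 \<and> a < n then 2 else 0)) * x"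
  by (auto simp: qsum_def)

lemma qsum_phi:
  assumes "M \<ge> 0"
  shows "qsum M n (\<lambda>k. phi b w k (phi b w (n - k) f) \<mu>) =
     b\<^sup>2 * (bquad b One One M n f \<mu> + bquad b One Two M n f \<mu> + bquad b Two One M n f \<mu> + bquad b Two Two M n f \<mu>)
     + 2 * (w One + w Two) * (phi b w n f \<mu> - (if n = 0 then (w One + w Two) * f \<mu> else 0))
     + (if n = 0 then (w One + w Two)\<^sup>2 * f \<mu> else 0)"
proof -
  let ?s = "w One + w Two" and ?l = "lin b (\<lambda>_ _. - b)"
  have "phi b w k (phi b w (n - k) f) \<mu> = ?l k (?l (n - k) f) \<mu>
      + ((if k = n then ?s * ?l n f \<mu> else 0) + (if k = 0 then ?s * ?l n f \<mu> else 0)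
      + (if k = 0 then if n = 0 then ?s\<^sup>2 * f \<mu> else 0 else 0))" for k
    unfolding phi_eq_lin lin_add lin_if lin_scale by (auto simp: power2_eq_square algebra_simps)
  then have "qsum M n (\<lambda>k. phi b w k (phi b w (n - k) f) \<mu>) = qsum M n (\<lambda>k. ?l k (?l (n - k) f) \<mu>)
      + (qsum M n (\<lambda>k. if k = n then ?s * ?l n f \<mu> else 0) + qsum M n (\<lambda>k. if k = 0 then ?s * ?l n f \<mu> else 0)
      + qsum M n (\<lambda>k. if k = 0 then if n = 0 then ?s\<^sup>2 * f \<mu> else 0 else 0))"
    by (simp only: qsum_add)
  also have "\<dots> = qsum M n (\<lambda>k. ?l k (?l (n - k) f) \<mu>) + 2 * ?s * ?l n f \<mu> + (if n = 0 then ?s\<^sup>2 * f \<mu> else 0)"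
    \<comment> \<open>Each product with one zero-mode factor counts twice in total: for n < 0 the
      indices 0 and n count once each, for n > 0 the index 0 is mixed and doubled.\<close>
    unfolding qsum_delta using assms by auto
  also have "qsum M n (\<lambda>k. ?l k (?l (n - k) f) \<mu>) = b\<^sup>2 * (bquad b One One M n f \<mu> + bquad b One Two M n f \<mu>
      + bquad b Two One M n f \<mu> + bquad b Two Two M n f \<mu>)"
    using qsum_lin[of M n b "\<lambda>_. - b" f \<mu>] by (simp add: algebra_simps power2_eq_square)
  finally show ?thesis
    by (simp add: phi_eq_lin)
qed

lemma vjet_const: "vjet (\<lambda>\<nu>. fls_const (f \<nu>)) f (\<lambda>_. 0) (\<lambda>_. 0)"
  by (simp add: vjet_def jet_const)

text \<open>The second current of \<open>T_mode\<close> is minus the first one at tz/q, so the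
  unspecified second-order coefficients cancel and only a term Q n from the shift survives. The
  result is the free field form of L in the difference of the two bosons, with background
  charge.\<close>

lemma L_mode_eq:
  assumes b: "b \<noteq> 0" and M: "int (weight \<mu>) \<le> M"
  shows "L_mode b w n f \<mu> = (if n = 0 then ((Q_par b)\<^sup>2 / 4 - (w One - w Two)\<^sup>2 / 4) * f \<mu> else 0)
    - b / 2 * (Q_par b * of_int n - (w One - w Two))
       * (boson (- 1 / b\<^sup>2) One n f \<mu> - boson (- 1 / b\<^sup>2) Two n f \<mu>)
    - b\<^sup>2 / 4 * (bquad b One One M n f \<mu> - bquad b One Two M n f \<mu> - bquad b Two One M n f \<mu> + bquad b Two Two M n f \<mu>)"
proof -
  let ?f = "\<lambda>\<nu>. fls_const (f \<nu>)"
  obtain d where J1: "current_jet b (bprime_cur b) (\<lambda>j. if j = One then - b / 2 else b / 2) d"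
    using bprime_jet[OF b] .
  have shift: "(\<lambda>j m. - bprime_cur b j m * (q_par b / t_par b) powi m)
      = (\<lambda>j m. - shift_arg (hexp (- Q_par b)) (bprime_cur b) j m)"
    by (intro ext) (simp add: shift_arg_def q_over_t hexp_powi mult.commute)
  have J2: "current_jet b (\<lambda>j m. - bprime_cur b j m * (q_par b / t_par b) powi m)
      (\<lambda>j. - (if j = One then - b / 2 else b / 2))
      (\<lambda>j n. - (d j n - - Q_par b * of_int n * (if j = One then - b / 2 else b / 2)))"
    unfolding shift by (rule current_jet_uminus[OF current_jet_shift[OF J1]])
  note N = nexp_jet[OF J1 vjet_const[of f] M, unfolded lin_0_vec, of n]
    nexp_jet[OF J2 vjet_const[of f] M, unfolded lin_0_vec, of n]
  have \<beta>: "- \<i> * beta1_zero w = (w One - w Two) / 2" "\<i> * beta1_zero w = - (w One - w Two) / 2"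
    by (simp_all add: beta1_zero_def)
  note T = jet_add[OF jet_mult[OF N(1) jet_hexp] jet_mult[OF N(2) jet_hexp],
      of "- \<i> * beta1_zero w" "\<i> * beta1_zero w"]
  have "\<exists>t0 t1. jet (T_mode b w n ?f \<mu>) t0 t1 ((if n = 0 then (w One - w Two)\<^sup>2 / 4 * f \<mu> else 0)
    + b / 2 * (Q_par b * of_int n - (w One - w Two))
       * (boson (- 1 / b\<^sup>2) One n f \<mu> - boson (- 1 / b\<^sup>2) Two n f \<mu>)
    + b\<^sup>2 / 4 * (bquad b One One M n f \<mu> - bquad b One Two M n f \<mu> - bquad b Two One M n f \<mu> + bquad b Two Two M n f \<mu>))"
    unfolding T_mode_def
  proof (intro exI, rule jet_cong[OF T refl refl], goal_cases)
    case 1 show ?case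
      unfolding qsum_lin
      unfolding lin_eq \<beta>
      by (cases "n = 0") (simp_all add: field_simps power2_eq_square)
  qed
  then have "fls_nth (T_mode b w n ?f \<mu>) 2 = (if n = 0 then (w One - w Two)\<^sup>2 / 4 * f \<mu> else 0)
    + b / 2 * (Q_par b * of_int n - (w One - w Two))
       * (boson (- 1 / b\<^sup>2) One n f \<mu> - boson (- 1 / b\<^sup>2) Two n f \<mu>)
    + b\<^sup>2 / 4 * (bquad b One One M n f \<mu> - bquad b One Two M n f \<mu> - bquad b Two One M n f \<mu> + bquad b Two Two M n f \<mu>)"
    by (auto simp: jet_def)
  then show ?thesis
    unfolding L_mode_def by (cases "n = 0") (simp_all add: algebra_simps)
qed

text \<open>The coefficient of \<open>\<hbar>\<^sup>2\<close> in \<open>X\<^sup>(\<^sup>2\<^sup>)\<close>, independent of the cutoff \<open>M\<close> once \<open>M \<ge> weight \<mu>\<close>.\<close>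

definition X2_second :: "complex \<Rightarrow> (idx \<Rightarrow> complex) \<Rightarrow> int \<Rightarrow> int \<Rightarrow> complex vec \<Rightarrow> mono \<Rightarrow> complex" where
  "X2_second b w M n f \<mu> =
     lin b (\<lambda>j n. if j = One then zeta b n + (if n < 0 then b * Q_par b * of_int n else 0)
       else zeta b n + b * Q_par b * of_int n / 2) n f \<mu>
     + b\<^sup>2 / 2 * (bquad b One One M n f \<mu> + bquad b One Two M n f \<mu> + bquad b Two One M n f \<mu> + bquad b Two Two M n f \<mu>)
     - (w One + w Two) * b * (boson (- 1 / b\<^sup>2) One n f \<mu> + boson (- 1 / b\<^sup>2) Two n f \<mu>)
     + (if n = 0 then (w One + w Two)\<^sup>2 / 2 * f \<mu> else 0)"

lemma X2_mode_jet:
  assumes b: "b \<noteq> 0" and f: "vjet f f0 f1 f2" and M: "int (weight \<mu>) \<le> M"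
  shows "jet (X_mode b w 2 n f \<mu>) (if n = 0 then f0 \<mu> else 0)
    ((if n = 0 then f1 \<mu> else 0) + phi b w n f0 \<mu>)
    ((if n = 0 then f2 \<mu> else 0) + phi b w n f1 \<mu> + X2_second b w M n f0 \<mu>)"
proof -
  have "X_mode b w 2 n f \<mu> = hexp (w One + w Two) * nexp b (\<lambda>j m. Lambda1_cur b j m
            + shift_arg (q_par b / t_par b) (Lambda2_cur b) j m) n f \<mu>"
    by (simp add: X_mode_def hexp_add)
  then show ?thesis
    using jet_mult[OF jet_hexp nexp_jet[OF X2_jet[OF b] f M], of "w One + w Two" n]
    unfolding qsum_lin
    by (elim ssubst jet_cong)
      (auto simp: phi_def X2_second_def lin_eq power2_eq_square field_simps)
qed

text \<open>Cross products of the two bosons occur in X^(2) but not in X^(1). The difference is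
  expressed by L, quadratic in the difference of the bosons, and the square of \<open>phi\<close>,
  quadratic in their sum. Keeping \<open>X2_second\<close> as a common part prepares its
  cancellation.\<close>

lemma X1_mode_jet:
  assumes b: "b \<noteq> 0" and f: "vjet f f0 f1 f2" and M: "int (weight \<mu>) \<le> M"
  shows "jet (X_mode b w 1 n f \<mu>) (if n = 0 then 2 * f0 \<mu> else 0)
    ((if n = 0 then 2 * f1 \<mu> else 0) + phi b w n f0 \<mu>)
    ((if n = 0 then 2 * f2 \<mu> else 0) + phi b w n f1 \<mu> + X2_second b w M n f0 \<mu>
     + (if n = 0 then (Q_par b)\<^sup>2 / 4 * f0 \<mu> else 0) - L_mode b w n f0 \<mu>
     - qsum M n (\<lambda>k. phi b w k (phi b w (n - k) f0) \<mu>) / 4 + Q_par b / 2 * of_int n * phi b w n f0 \<mu>)"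
proof -
  have M0: "M \<ge> 0" using M by simp
  have X: "X_mode b w 1 n f \<mu> = hexp (w One) * nexp b (Lambda1_cur b) n f \<mu> + hexp (w Two) * nexp b (Lambda2_cur b) n f \<mu>"
    by (simp add: X_mode_def)
  note T = jet_add[OF jet_mult[OF jet_hexp nexp_jet[OF Lambda1_jet[OF b] f M]]
      jet_mult[OF jet_hexp nexp_jet[OF Lambda2_jet[OF b] f M]], of "w One" n "w Two" n]
  show ?thesis
    unfolding X
  proof (rule jet_cong[OF T], goal_cases)
    case 1 show ?case by simp
  next
    case 2 show ?case by (simp add: phi_def lin_eq algebra_simps)
  next
    case 3 show ?case
      unfolding qsum_lin qsum_phi[OF M0] L_mode_eq[OF b M]
      by (cases "n = 0") (simp_all add: phi_def X2_second_def lin_eq power2_eq_square field_simps)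
  qed
qed

section \<open>Commutators with a homogeneous operator\<close>

definition homogeneous :: "int \<Rightarrow> 'k::field vec \<Rightarrow> bool" where
  "homogeneous d f \<longleftrightarrow> (\<forall>\<mu>. f \<mu> \<noteq> 0 \<longrightarrow> int (weight \<mu>) = d)"

lemma homogeneous_twist: "homogeneous d f \<longleftrightarrow> twist (\<lambda>w. of_bool (w = d)) f = f"
  by (auto simp: homogeneous_def twist_def fun_eq_iff)

lemma homogeneous_mode:
  fixes A :: "'k::field vec \<Rightarrow> 'k vec"
  assumes A: "\<And>g. A (twist g f) = twist (\<lambda>w. g (w + n)) (A f)" and f: "homogeneous d f"
  shows "homogeneous (d - n) (A f)"
proof -
  have "A f = twist (\<lambda>w. of_bool (w + n = d)) (A f)"
    using A[of "\<lambda>w. of_bool (w = d)"] f by (simp add: homogeneous_twist)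
  moreover have "(\<lambda>w. of_bool (w + n = d)) = (\<lambda>w. of_bool (w = d - n) :: 'k)"
    by auto
  ultimately show ?thesis by (simp add: homogeneous_twist)
qed

lemma homogeneous_basis: "homogeneous (int (weight \<nu>)) (basis \<nu>)"
  by (simp add: homogeneous_def basis_def)

lemma homogeneous_neg: "homogeneous d f \<Longrightarrow> d < 0 \<Longrightarrow> f = (\<lambda>_. 0)"
  by (force simp: homogeneous_def)

section \<open>Linear extension on homogeneous vectors\<close>

definition level :: "int \<Rightarrow> mono set" where
  "level d = {\<mu>. int (weight \<mu>) = d}"

lemma in_level [simp]: "\<mu> \<in> level d \<longleftrightarrow> int (weight \<mu>) = d"
  by (simp add: level_def)

lemma size_le_weight: "size \<mu> \<le> weight \<mu>"
  by (induction \<mu>) (simp_all add: weight_add_mset)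

lemma mode_le_weight: "p \<in># \<mu> \<Longrightarrow> snd p < weight \<mu>"
  using weight_diff[of p \<mu>] by simp

lemma finite_level [simp]: "finite (level d)"
proof -
  let ?A = "{One, Two} \<times> {..nat d}"
  have "level d \<subseteq> (\<Union>s\<le>nat d. {\<mu>. set_mset \<mu> \<subseteq> ?A \<and> size \<mu> = s})"
  proof
    fix \<mu> assume "\<mu> \<in> level d"
    then have d: "weight \<mu> = nat d" by auto
    have "p \<in> ?A" if "p \<in># \<mu>" for p
      using mode_le_weight[OF that] d by (cases p; cases "fst p") auto
    moreover have "size \<mu> \<le> nat d"
      using size_le_weight[of \<mu>] d by simp
    ultimately have "set_mset \<mu> \<subseteq> ?A" "size \<mu> \<le> nat d" by auto
    then show "\<mu> \<in> (\<Union>s\<le>nat d. {\<mu>. set_mset \<mu> \<subseteq> ?A \<and> size \<mu> = s})" by auto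
  qed
  moreover have "finite (\<Union>s\<le>nat d. {\<mu>. set_mset \<mu> \<subseteq> ?A \<and> size \<mu> = s})"
    by (intro finite_UN_I finite_multisets_of_size[unfolded multisets_of_size_def]) auto
  ultimately show ?thesis by (rule finite_subset)
qed

text \<open>\<open>extend\<close> sums over the support of its argument, which obstructs linearity;
  on homogeneous vectors it agrees with this sum over a fixed finite level.\<close>

definition esum :: "int \<Rightarrow> 'k::field lmap \<Rightarrow> 'k vec \<Rightarrow> 'k vec" where
  "esum d V f = (\<lambda>\<mu>. \<Sum>\<nu>\<in>level d. f \<nu> * V \<nu> \<mu>)"

lemma extend_esum: "homogeneous d f \<Longrightarrow> extend V f \<mu> = esum d V f \<mu>"
  unfolding extend_def esum_def
  by (rule sum.mono_neutral_left) (auto simp: homogeneous_def)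

lemma esum_basis: "weight \<nu> = d \<Longrightarrow> esum d V (basis \<nu>) \<mu> = V \<nu> \<mu>"
proof -
  assume "weight \<nu> = d"
  then have "esum d V (basis \<nu>) \<mu> = (\<Sum>\<nu>'\<in>level d. if \<nu>' = \<nu> then V \<nu> \<mu> else 0)"
    unfolding esum_def by (intro sum.cong) (auto simp: basis_def)
  with \<open>weight \<nu> = d\<close> show ?thesis by simp
qed

lemma homogeneous_expand: "homogeneous d f \<Longrightarrow> f = (\<lambda>\<mu>. \<Sum>\<nu>\<in>level d. f \<nu> * basis \<nu> \<mu>)"
proof
  fix \<mu> assume "homogeneous d f"
  have "(\<Sum>\<nu>\<in>level d. f \<nu> * basis \<nu> \<mu>) = (\<Sum>\<nu>\<in>level d. if \<nu> = \<mu> then f \<mu> else 0)"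
    by (intro sum.cong) (auto simp: basis_def)
  with \<open>homogeneous d f\<close> show "f \<mu> = (\<Sum>\<nu>\<in>level d. f \<nu> * basis \<nu> \<mu>)"
    by (auto simp: homogeneous_def)
qed

lemma phi_twist: "phi b w n (twist g f) = twist (\<lambda>w. g (w + n)) (phi b w n f)"
  by (rule ext) (simp add: phi_eq_lin lin_twist twist_apply algebra_simps)

lemma L_mode_twist: "L_mode b w n (twist g f) = twist (\<lambda>w. g (w + n)) (L_mode b w n f)"
proof
  fix \<mu>
  have "(\<lambda>\<nu>. fls_const (twist g f \<nu>)) = twist (\<lambda>w. fls_const (g w)) (\<lambda>\<nu>. fls_const (f \<nu>))"
    by (simp add: twist_def)
  then show "L_mode b w n (twist g f) \<mu> = twist (\<lambda>w. g (w + n)) (L_mode b w n f) \<mu>"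
    by (simp add: L_mode_def T_mode_twist twist_apply algebra_simps)
qed

lemma homogeneous_phi: "homogeneous d f \<Longrightarrow> homogeneous (d - n) (phi b w n f)"
  by (rule homogeneous_mode[where A = "phi b w n"]) (rule phi_twist)

lemma homogeneous_L_mode: "homogeneous d f \<Longrightarrow> homogeneous (d - n) (L_mode b w n f)"
  by (rule homogeneous_mode[where A = "L_mode b w n"]) (rule L_mode_twist)

lemma homogeneous_X_mode: "homogeneous d f \<Longrightarrow> homogeneous (d - n) (X_mode b w i n f)"
  by (rule homogeneous_mode[where A = "X_mode b w i n"]) (rule X_mode_twist)

lemma boson_sum: "boson c i n (\<lambda>\<mu>. \<Sum>\<nu>\<in>A. f \<nu> \<mu>) = (\<lambda>\<mu>. \<Sum>\<nu>\<in>A. boson c i n (f \<nu>) \<mu>)"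
  by (rule ext) (simp add: boson_def Let_def sum_distrib_left)

lemma phi_sum: "phi b w n (\<lambda>\<mu>. \<Sum>\<nu>\<in>A. f \<nu> \<mu>) = (\<lambda>\<mu>. \<Sum>\<nu>\<in>A. phi b w n (f \<nu>) \<mu>)"
  by (rule ext) (simp add: phi_def boson_sum sum.distrib sum_subtractf sum_negf sum_distrib_left distrib_left)

lemma phi_scale: "phi b w n (\<lambda>\<mu>. a * f \<mu>) = (\<lambda>\<mu>. a * phi b w n f \<mu>)"
  by (rule ext) (simp add: phi_eq_lin lin_scale algebra_simps)

lemma phi_add: "phi b w n (\<lambda>\<mu>. f \<mu> + g \<mu>) = (\<lambda>\<mu>. phi b w n f \<mu> + phi b w n g \<mu>)"
  by (rule ext) (simp add: phi_eq_lin lin_add algebra_simps)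

lemma phi_extend:
  assumes comm: "\<And>\<nu> \<mu>. commut (phi b v k) (phi b u k) V \<nu> \<mu> = h * V \<nu> \<mu>" and g: "homogeneous d g"
  shows "phi b v k (extend V g) \<mu> = extend V (phi b u k g) \<mu> + h * extend V g \<mu>"
proof -
  have c: "phi b v k (V \<nu>) \<mu> = extend V (phi b u k (basis \<nu>)) \<mu> + h * V \<nu> \<mu>" for \<nu>
    using comm[of \<nu> \<mu>] by (simp add: commut_def algebra_simps)
  have "phi b v k (extend V g) \<mu> = (\<Sum>\<nu>\<in>level d. g \<nu> * phi b v k (V \<nu>) \<mu>)"
    unfolding extend_esum[OF g, abs_def] esum_def phi_sum phi_scale ..
  also have "\<dots> = (\<Sum>\<nu>\<in>level d. g \<nu> * extend V (phi b u k (basis \<nu>)) \<mu>) + h * extend V g \<mu>"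
    unfolding extend_esum[OF g] esum_def c by (simp add: algebra_simps sum.distrib sum_distrib_left)
  also have "(\<Sum>\<nu>\<in>level d. g \<nu> * extend V (phi b u k (basis \<nu>)) \<mu>)
     = (\<Sum>\<nu>\<in>level d. \<Sum>\<nu>'\<in>level (d - k). g \<nu> * phi b u k (basis \<nu>) \<nu>' * V \<nu>' \<mu>)"
  proof (rule sum.cong)
    fix \<nu> assume "\<nu> \<in> level d"
    then have "homogeneous (d - k) (phi b u k (basis \<nu>))"
      using homogeneous_phi[OF homogeneous_basis[of \<nu>], of k b u] by simp
    then show "g \<nu> * extend V (phi b u k (basis \<nu>)) \<mu>
        = (\<Sum>\<nu>'\<in>level (d - k). g \<nu> * phi b u k (basis \<nu>) \<nu>' * V \<nu>' \<mu>)"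
      by (simp add: extend_esum esum_def sum_distrib_left mult.assoc)
  qed simp
  also have "\<dots> = (\<Sum>\<nu>'\<in>level (d - k). phi b u k (\<lambda>\<mu>. \<Sum>\<nu>\<in>level d. g \<nu> * basis \<nu> \<mu>) \<nu>' * V \<nu>' \<mu>)"
    unfolding phi_sum phi_scale sum_distrib_right by (rule sum.swap)
  also have "\<dots> = extend V (phi b u k g) \<mu>"
    unfolding homogeneous_expand[OF g, symmetric] extend_esum[OF homogeneous_phi[OF g]] esum_def ..
  finally show ?thesis .
qed

text \<open>Leibniz rule for the commutator with a product. V ends up to the left of one
  \<open>phi\<close> and to the right of the other, as normal ordering requires.\<close>

lemma phi_phi_commut:
  assumes comm: "\<And>k \<nu> \<mu>. commut (phi b v k) (phi b u k) V \<nu> \<mu> = h k * V \<nu> \<mu>"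
  shows "phi b v k (phi b v l (V \<nu>)) \<mu> - extend V (phi b u k (phi b u l (basis \<nu>))) \<mu>
    = h k * extend V (phi b u l (basis \<nu>)) \<mu> + h l * phi b v k (V \<nu>) \<mu>"
proof -
  have "phi b v l (V \<nu>) = (\<lambda>\<mu>. extend V (phi b u l (basis \<nu>)) \<mu> + h l * V \<nu> \<mu>)"
    using comm[of l \<nu>] by (auto simp: commut_def fun_eq_iff algebra_simps)
  then have "phi b v k (phi b v l (V \<nu>)) \<mu>
      = phi b v k (extend V (phi b u l (basis \<nu>))) \<mu> + h l * phi b v k (V \<nu>) \<mu>"
    by (simp only: phi_add phi_scale)
  with phi_extend[OF comm homogeneous_phi[OF homogeneous_basis[of \<nu>], of l b u]] show ?thesis by simp
qed

text \<open>\<open>L k\<close> and \<open>R k\<close> stand for mode k of \<open>phi\<close> to the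
  left and right of the vertex operator; \<open>S\<close> keeps modes k <= 0 on the left and k > 0
  on the right. Reordering into \<open>S\<close> costs a scalar h(k) h(n - k) for the n - 1 indices
  strictly between 0 and n, and minus such a scalar for the 1 - n indices in n..0.\<close>

lemma qsum_commut:
  fixes x p r V :: complex and L R :: "int \<Rightarrow> complex"
  defines "h \<equiv> \<lambda>k::int. (if k > 0 then p else r) * x powi k"
  assumes x: "x \<noteq> 0" and LR: "\<And>k. L k = R k + h k * V" and M: "\<bar>n\<bar> \<le> M"
  defines "S \<equiv> \<lambda>k. if k > 0 then R k else L k"
  shows "qsum M n (\<lambda>k. h k * R (n - k) + h (n - k) * L k)
    = 2 * (\<Sum>k\<in>{- M..n + M}. h (n - k) * S k)
      + (if n > 0 then p\<^sup>2 else r\<^sup>2) * of_int (n - 1) * x powi n * V"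
proof -
  have xx: "x powi k * x powi (n - k) = x powi n" for k
    using x by (simp add: power_int_add[symmetric])
  have hh: "h k * h (n - k) = p\<^sup>2 * x powi n" if "k \<in> {0<..<n}" for k
    using that xx[of k] by (simp add: h_def power2_eq_square mult_ac)
  have hh': "h k * h (n - k) = r\<^sup>2 * x powi n" if "k \<in> {n..0}" for k
    using that xx[of k] by (simp add: h_def power2_eq_square mult_ac)
  have 1: "(\<Sum>k\<in>{0<..<n}. h k * R (n - k) + h (n - k) * L k)
      = 2 * (\<Sum>k\<in>{0<..<n}. h (n - k) * S k) + (if n > 0 then p\<^sup>2 * of_int (n - 1) * x powi n * V else 0)"
  proof -
    have "(\<Sum>k\<in>{0<..<n}. h k * R (n - k)) = (\<Sum>k\<in>{0<..<n}. h (n - k) * S k)"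
      by (rule sum.reindex_bij_witness[where i = "\<lambda>k. n - k" and j = "\<lambda>k. n - k"]) (auto simp: S_def)
    moreover have "(\<Sum>k\<in>{0<..<n}. h (n - k) * L k) = (\<Sum>k\<in>{0<..<n}. h (n - k) * S k + p\<^sup>2 * x powi n * V)"
      using hh by (intro sum.cong) (auto simp: S_def LR algebra_simps)
    moreover have "complex_of_nat (card {0<..<n}) = (if n > 0 then of_int (n - 1) else 0)"
      by (simp add: of_nat_nat)
    ultimately show ?thesis
      by (simp add: sum.distrib algebra_simps)
  qed
  have 2: "(\<Sum>k\<in>{n..0}. h k * R (n - k) + h (n - k) * L k)
      = 2 * (\<Sum>k\<in>{n..0}. h (n - k) * S k) + (if n > 0 then 0 else r\<^sup>2 * of_int (n - 1) * x powi n * V)"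
  proof -
    have "(\<Sum>k\<in>{n..0}. h k * R (n - k)) = (\<Sum>k\<in>{n..0}. h (n - k) * R k)"
      by (rule sum.reindex_bij_witness[where i = "\<lambda>k. n - k" and j = "\<lambda>k. n - k"]) auto
    also have "\<dots> = (\<Sum>k\<in>{n..0}. h (n - k) * S k - r\<^sup>2 * x powi n * V)"
      using hh' by (intro sum.cong) (auto simp: S_def LR algebra_simps)
    finally have "(\<Sum>k\<in>{n..0}. h k * R (n - k)) = (\<Sum>k\<in>{n..0}. h (n - k) * S k - r\<^sup>2 * x powi n * V)" .
    moreover have "(\<Sum>k\<in>{n..0}. h (n - k) * L k) = (\<Sum>k\<in>{n..0}. h (n - k) * S k)"
      by (intro sum.cong) (auto simp: S_def)
    moreover have "complex_of_nat (card {n..0}) = (if n > 0 then 0 else of_int (1 - n))"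
      by (simp add: of_nat_nat)
    ultimately show ?thesis
      by (cases "n > 0") (simp_all add: sum.distrib sum_subtractf algebra_simps)
  qed
  \<comment> \<open>Mixed products are already ordered; reflecting k to n - k moves one of the two
    sums to the indices from max n 1 upwards.\<close>
  have 3: "(\<Sum>k\<in>{- M..min 0 (n - 1)}. h k * R (n - k) + h (n - k) * L k)
      = (\<Sum>k\<in>{max n 1..n + M}. h (n - k) * S k) + (\<Sum>k\<in>{- M..min 0 (n - 1)}. h (n - k) * S k)"
  proof -
    have "(\<Sum>k\<in>{- M..min 0 (n - 1)}. h k * R (n - k)) = (\<Sum>k\<in>{max n 1..n + M}. h (n - k) * S k)"
      by (rule sum.reindex_bij_witness[where i = "\<lambda>k. n - k" and j = "\<lambda>k. n - k"]) (auto simp: S_def)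
    moreover have "(\<Sum>k\<in>{- M..min 0 (n - 1)}. h (n - k) * L k) = (\<Sum>k\<in>{- M..min 0 (n - 1)}. h (n - k) * S k)"
      by (intro sum.cong) (auto simp: S_def)
    ultimately show ?thesis by (simp add: sum.distrib)
  qed
  define G where "G k = h (n - k) * S k" for k
  \<comment> \<open>At least one of the last two ranges is empty, and the four together tile the
    interval.\<close>
  have "{- M..n + M} = {- M..min 0 (n - 1)} \<union> ({max n 1..n + M} \<union> ({0<..<n} \<union> {n..0}))"
    using M by auto
  then have "sum G {- M..n + M} = sum G ({- M..min 0 (n - 1)} \<union> ({max n 1..n + M} \<union> ({0<..<n} \<union> {n..0})))"
    by (rule arg_cong)
  also have "\<dots> = sum G {- M..min 0 (n - 1)} + sum G ({max n 1..n + M} \<union> ({0<..<n} \<union> {n..0}))"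
    by (rule sum.union_disjoint) (simp_all, fastforce)
  also have "sum G ({max n 1..n + M} \<union> ({0<..<n} \<union> {n..0}))
      = sum G {max n 1..n + M} + sum G ({0<..<n} \<union> {n..0})"
    by (rule sum.union_disjoint) (simp_all, fastforce)
  also have "sum G ({0<..<n} \<union> {n..0}) = sum G {0<..<n} + sum G {n..0}"
    by (rule sum.union_disjoint) (simp_all, fastforce)
  finally show ?thesis
    unfolding qsum_def 1 2 3 G_def by (simp add: algebra_simps)
qed

section \<open>The intertwining relations\<close>

lemma esum_add: "esum d V (\<lambda>\<nu>. f \<nu> + g \<nu>) \<mu> = esum d V f \<mu> + esum d V g \<mu>"
  by (simp add: esum_def algebra_simps sum.distrib)

lemma esum_diff: "esum d V (\<lambda>\<nu>. f \<nu> - g \<nu>) \<mu> = esum d V f \<mu> - esum d V g \<mu>"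
  by (simp add: esum_def algebra_simps sum_subtractf)

lemma esum_scale: "esum d V (\<lambda>\<nu>. a * f \<nu>) \<mu> = a * esum d V f \<mu>"
  by (simp add: esum_def sum_distrib_left mult.assoc)

lemma esum_zero: "esum d V (\<lambda>\<nu>. 0) \<mu> = 0"
  by (simp add: esum_def)

lemma esum_qsum: "esum d V (\<lambda>\<nu>. qsum M n (\<lambda>k. F k \<nu>)) \<mu> = qsum M n (\<lambda>k. esum d V (F k) \<mu>)"
  unfolding esum_def qsum_sum by (simp add: qsum_scale[symmetric] mult.commute)

lemma esum_basis_if: "esum (int (weight \<nu>) - n) V (\<lambda>\<mu>. if n = 0 then a * basis \<nu> \<mu> else 0) \<mu> = (if n = 0 then a * V \<nu> \<mu> else 0)"
  by (simp add: esum_zero esum_scale esum_basis)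

lemma jet_esum:
  assumes "\<And>\<nu>. \<nu> \<in> level d \<Longrightarrow> jet (g \<nu>) (g0 \<nu>) (g1 \<nu>) (g2 \<nu>)"
    and "\<And>\<nu>. vjet (V \<nu>) (V0 \<nu>) (V1 \<nu>) (V2 \<nu>)"
  shows "jet (esum d V g \<mu>) (esum d V0 g0 \<mu>) (esum d V1 g0 \<mu> + esum d V0 g1 \<mu>)
    (esum d V2 g0 \<mu> + esum d V1 g1 \<mu> + esum d V0 g2 \<mu>)"
  unfolding esum_def sum.distrib[symmetric]
  by (intro jet_sum jet_mult assms(1)) (use assms(2) in \<open>auto simp: vjet_def\<close>)

lemma vjet_basis: "vjet (basis \<nu>) (basis \<nu>) (\<lambda>_. 0) (\<lambda>_. 0)"
  by (simp add: vjet_def basis_def jet_0 jet_1)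

lemma phi_zero [simp]: "phi b w n (\<lambda>_. 0) = (\<lambda>_. 0)"
  by (rule ext) (simp add: phi_def)

context
  fixes b x :: complex and u v :: "idx \<Rightarrow> complex" and V :: "hser lmap" and V0 V1 V2 :: "complex lmap"
  assumes b: "b \<noteq> 0" and V: "intertwiner b u v x V"
    and VJ: "\<And>\<nu>. vjet (V \<nu>) (V0 \<nu>) (V1 \<nu>) (V2 \<nu>)"
begin

lemma extend_X2_jet:
  assumes "int (weight \<nu>) - n \<le> M"
  shows "jet (extend V (X_mode b u 2 n (basis \<nu>)) \<mu>) (if n = 0 then V0 \<nu> \<mu> else 0)
    ((if n = 0 then V1 \<nu> \<mu> else 0) + extend V0 (phi b u n (basis \<nu>)) \<mu>)
    ((if n = 0 then V2 \<nu> \<mu> else 0) + extend V1 (phi b u n (basis \<nu>)) \<mu>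
      + esum (int (weight \<nu>) - n) V0 (X2_second b u M n (basis \<nu>)) \<mu>)"
proof -
  let ?d = "int (weight \<nu>) - n"
  have "jet (X_mode b u 2 n (basis \<nu>) \<mu>') (if n = 0 then 1 * basis \<nu> \<mu>' else 0) (phi b u n (basis \<nu>) \<mu>')
      (X2_second b u M n (basis \<nu>) \<mu>')" if "\<mu>' \<in> level ?d" for \<mu>'
    by (rule jet_cong[OF X2_mode_jet[OF b vjet_basis[of \<nu>], of \<mu>' M u n]]) (use that assms in simp_all)
  then have "jet (esum ?d V (X_mode b u 2 n (basis \<nu>)) \<mu>) (esum ?d V0 (\<lambda>\<mu>. if n = 0 then 1 * basis \<nu> \<mu> else 0) \<mu>)
     (esum ?d V1 (\<lambda>\<mu>. if n = 0 then 1 * basis \<nu> \<mu> else 0) \<mu> + esum ?d V0 (phi b u n (basis \<nu>)) \<mu>)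
     (esum ?d V2 (\<lambda>\<mu>. if n = 0 then 1 * basis \<nu> \<mu> else 0) \<mu> + esum ?d V1 (phi b u n (basis \<nu>)) \<mu>
      + esum ?d V0 (X2_second b u M n (basis \<nu>)) \<mu>)"
    using VJ by (rule jet_esum)
  then show ?thesis
    unfolding esum_basis_if extend_esum[OF homogeneous_X_mode[OF homogeneous_basis]] extend_esum[OF homogeneous_phi[OF homogeneous_basis]]
    by (simp only: mult_1_left)
qed

lemma extend_X1_jet:
  assumes M: "int (weight \<nu>) - n \<le> M"
  shows "jet (extend V (X_mode b u 1 n (basis \<nu>)) \<mu>) (if n = 0 then 2 * V0 \<nu> \<mu> else 0)
    ((if n = 0 then 2 * V1 \<nu> \<mu> else 0) + extend V0 (phi b u n (basis \<nu>)) \<mu>)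
    ((if n = 0 then 2 * V2 \<nu> \<mu> else 0) + extend V1 (phi b u n (basis \<nu>)) \<mu>
      + esum (int (weight \<nu>) - n) V0 (X2_second b u M n (basis \<nu>)) \<mu>
      + (if n = 0 then (Q_par b)\<^sup>2 / 4 * V0 \<nu> \<mu> else 0) - extend V0 (L_mode b u n (basis \<nu>)) \<mu>
      - qsum M n (\<lambda>k. extend V0 (phi b u k (phi b u (n - k) (basis \<nu>))) \<mu>) / 4
      + Q_par b / 2 * of_int n * extend V0 (phi b u n (basis \<nu>)) \<mu>)"
proof -
  let ?d = "int (weight \<nu>) - n"
  have "jet (X_mode b u 1 n (basis \<nu>) \<mu>') (if n = 0 then 2 * basis \<nu> \<mu>' else 0) (phi b u n (basis \<nu>) \<mu>')
      (X2_second b u M n (basis \<nu>) \<mu>'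
     + (if n = 0 then (Q_par b)\<^sup>2 / 4 * basis \<nu> \<mu>' else 0) - L_mode b u n (basis \<nu>) \<mu>'
     - 1 / 4 * qsum M n (\<lambda>k. phi b u k (phi b u (n - k) (basis \<nu>)) \<mu>')
     + (Q_par b / 2 * of_int n) * phi b u n (basis \<nu>) \<mu>')" if "\<mu>' \<in> level ?d" for \<mu>'
    by (rule jet_cong[OF X1_mode_jet[OF b vjet_basis[of \<nu>], of \<mu>' M u n]]) (use that M in simp_all)
  then have J: "jet (esum ?d V (X_mode b u 1 n (basis \<nu>)) \<mu>) (esum ?d V0 (\<lambda>\<mu>. if n = 0 then 2 * basis \<nu> \<mu> else 0) \<mu>)
     (esum ?d V1 (\<lambda>\<mu>. if n = 0 then 2 * basis \<nu> \<mu> else 0) \<mu> + esum ?d V0 (phi b u n (basis \<nu>)) \<mu>)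
     (esum ?d V2 (\<lambda>\<mu>. if n = 0 then 2 * basis \<nu> \<mu> else 0) \<mu> + esum ?d V1 (phi b u n (basis \<nu>)) \<mu>
      + esum ?d V0 (\<lambda>\<mu>'. X2_second b u M n (basis \<nu>) \<mu>'
         + (if n = 0 then (Q_par b)\<^sup>2 / 4 * basis \<nu> \<mu>' else 0) - L_mode b u n (basis \<nu>) \<mu>'
         - 1 / 4 * qsum M n (\<lambda>k. phi b u k (phi b u (n - k) (basis \<nu>)) \<mu>')
         + (Q_par b / 2 * of_int n) * phi b u n (basis \<nu>) \<mu>') \<mu>)"
    using VJ by (rule jet_esum)
  have "homogeneous ?d (phi b u k (phi b u (n - k) (basis \<nu>)))" for k
    using homogeneous_phi[OF homogeneous_phi[OF homogeneous_basis[of \<nu>], of "n - k" b u], of k b u] by simp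
  from extend_esum[OF this] J show ?thesis
    unfolding esum_basis_if extend_esum[OF homogeneous_X_mode[OF homogeneous_basis]] extend_esum[OF homogeneous_phi[OF homogeneous_basis]]
      extend_esum[OF homogeneous_L_mode[OF homogeneous_basis]] esum_add esum_diff esum_scale esum_qsum
    by (simp add: algebra_simps)
qed

text \<open>Coefficient of hbar in the relation for X^(2). The \<open>V1\<close> terms cancel, and
  the inhomogeneity at n = 1 is the first-order term of (t/q)^2 multiplying the constant coefficient
  of mode 0.\<close>

lemma intertwiner_phi_recurrence:
  "commut (phi b v n) (phi b u n) V0 \<nu> \<mu> - x * commut (phi b v (n - 1)) (phi b u (n - 1)) V0 \<nu> \<mu>
    = (if n = 1 then 2 * Q_par b * x * V0 \<nu> \<mu> else 0)"
proof -
  define M where "M = int (weight \<mu>) + int (weight \<nu>) + \<bar>n\<bar> + 1"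
  have M: "int (weight \<mu>) \<le> M" "int (weight \<nu>) - n \<le> M" "int (weight \<nu>) - (n - 1) \<le> M"
    by (auto simp: M_def)
  have eq: "X_mode b v 2 n (V \<nu>) \<mu> - fls_const x * X_mode b v 2 (n - 1) (V \<nu>) \<mu>
      = extend V (X_mode b u 2 n (basis \<nu>)) \<mu>
        - hexp (- 2 * Q_par b) * (fls_const x * extend V (X_mode b u 2 (n - 1) (basis \<nu>)) \<mu>)"
    using V unfolding intertwiner_def t_over_q hexp_power by (simp add: mult.assoc)
  note T = jet_diff[OF X2_mode_jet[OF b VJ M(1)] jet_const_mult[OF X2_mode_jet[OF b VJ M(1)]], of v n \<nu> x v "n - 1" \<nu>]
  note S = jet_diff[OF extend_X2_jet[OF M(2)] jet_mult[OF jet_hexp jet_const_mult[OF extend_X2_jet[OF M(3)]]],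
      of \<mu> "- 2 * Q_par b" x \<mu>]
  show ?thesis
    using jet_unique[OF T[unfolded eq] S] unfolding commut_def
    by (cases "n = 1") (auto simp: algebra_simps split: if_splits)
qed

text \<open>Difference of the two relations at order hbar^2. All terms with \<open>V1\<close>,
  \<open>V2\<close> and \<open>X2_second\<close> cancel; the right-hand side comes from expanding
  t/q against its square, whose first-order terms -Q and -2Q multiply the same
  \<open>phi\<close>.\<close>

lemma intertwiner_L_recurrence:
  assumes M: "int (weight \<mu>) \<le> M" "int (weight \<nu>) - n \<le> M" "int (weight \<nu>) - (n - 1) \<le> M"
  defines "C \<equiv> \<lambda>n. qsum M n (\<lambda>k. phi b v k (phi b v (n - k) (V0 \<nu>)) \<mu>
      - extend V0 (phi b u k (phi b u (n - k) (basis \<nu>))) \<mu>)"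
  defines "D \<equiv> \<lambda>n. - commut (L_mode b v n) (L_mode b u n) V0 \<nu> \<mu> - C n / 4
      + Q_par b / 2 * of_int n * commut (phi b v n) (phi b u n) V0 \<nu> \<mu>"
  shows "D n - x * D (n - 1) = - Q_par b * x * extend V0 (phi b u (n - 1) (basis \<nu>)) \<mu>
    + (if n = 1 then (Q_par b)\<^sup>2 * x * V0 \<nu> \<mu> else 0)"
proof -
  have eq2: "X_mode b v 2 n (V \<nu>) \<mu> - fls_const x * X_mode b v 2 (n - 1) (V \<nu>) \<mu>
      = extend V (X_mode b u 2 n (basis \<nu>)) \<mu>
        - hexp (- 2 * Q_par b) * (fls_const x * extend V (X_mode b u 2 (n - 1) (basis \<nu>)) \<mu>)"
    using V unfolding intertwiner_def t_over_q hexp_power by (simp add: mult.assoc)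
  have eq1: "X_mode b v 1 n (V \<nu>) \<mu> - fls_const x * X_mode b v 1 (n - 1) (V \<nu>) \<mu>
      = extend V (X_mode b u 1 n (basis \<nu>)) \<mu>
        - hexp (- Q_par b) * (fls_const x * extend V (X_mode b u 1 (n - 1) (basis \<nu>)) \<mu>)"
    using V unfolding intertwiner_def t_over_q hexp_power by (simp add: mult.assoc)
  note T2 = jet_diff[OF X2_mode_jet[OF b VJ M(1)] jet_const_mult[OF X2_mode_jet[OF b VJ M(1)]], of v n \<nu> x v "n - 1" \<nu>]
  note S2 = jet_diff[OF extend_X2_jet[OF M(2)] jet_mult[OF jet_hexp jet_const_mult[OF extend_X2_jet[OF M(3)]]],
      of \<mu> "- 2 * Q_par b" x \<mu>]
  note T1 = jet_diff[OF X1_mode_jet[OF b VJ M(1)] jet_const_mult[OF X1_mode_jet[OF b VJ M(1)]], of v n \<nu> x v "n - 1" \<nu>]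
  note S1 = jet_diff[OF extend_X1_jet[OF M(2)] jet_mult[OF jet_hexp jet_const_mult[OF extend_X1_jet[OF M(3)]]],
      of \<mu> "- Q_par b" x \<mu>]
  note E2 = jet_unique[OF T2[unfolded eq2] S2, THEN conjunct2, THEN conjunct2]
  note E1 = jet_unique[OF T1[unfolded eq1] S1, THEN conjunct2, THEN conjunct2]
  have C: "C m = qsum M m (\<lambda>k. phi b v k (phi b v (m - k) (V0 \<nu>)) \<mu>)
      - qsum M m (\<lambda>k. extend V0 (phi b u k (phi b u (m - k) (basis \<nu>))) \<mu>)" for m
    unfolding C_def by (rule qsum_diff)
  show ?thesis
    using arg_cong2[OF E1 E2, of "(-)"] unfolding D_def C commut_def
    by (cases "n = 1"; cases "n = 0") (simp_all add: algebra_simps power2_eq_square diff_divide_distrib)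
qed

end

section \<open>Dependence of the vertex operator on its position\<close>

lemma extend_homogeneous:
  assumes g: "homogeneous d g"
  shows "extend (\<lambda>\<nu> \<mu>. fls_const (x powi (int (weight \<mu>) - int (weight \<nu>))) * V \<nu> \<mu>) g \<mu>
    = fls_const (x powi (int (weight \<mu>) - d)) * extend V g \<mu>"
  unfolding extend_esum[OF g] esum_def sum_distrib_left
  by (rule sum.cong) auto

text \<open>Conjugation by x to the power of the degree moves the position from 1 to x: mode n of X
  shifts the degree by n, and the explicit factor x in the relation makes up for the index n - 1, so
  every term acquires the same power.\<close>

lemma intertwiner_rescale:
  assumes V: "intertwiner b u v 1 V" and x: "x \<noteq> 0"
  shows "intertwiner b u v x (\<lambda>\<nu> \<mu>. fls_const (x powi (int (weight \<mu>) - int (weight \<nu>))) * V \<nu> \<mu>)"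
    (is "intertwiner b u v x ?W")
  unfolding intertwiner_def
proof (intro conjI ballI allI)
  show "?W {#} {#} = 1"
    using V by (simp add: intertwiner_def)
next
  fix i :: nat and n \<nu> \<mu> assume i: "i \<in> {1, 2}"
  let ?e = "fls_const (x powi (int (weight \<mu>) + n - int (weight \<nu>)))"
  have W: "?W \<nu> = twist (\<lambda>w. fls_const (x powi (w - int (weight \<nu>)))) (V \<nu>)"
    by (simp add: twist_def)
  have X: "X_mode b v i m (?W \<nu>) \<mu> = fls_const (x powi (int (weight \<mu>) + m - int (weight \<nu>))) * X_mode b v i m (V \<nu>) \<mu>" for m
    unfolding W X_mode_twist twist_apply ..
  have E: "extend ?W (X_mode b u i m (basis \<nu>)) \<mu>
      = fls_const (x powi (int (weight \<mu>) + m - int (weight \<nu>))) * extend V (X_mode b u i m (basis \<nu>)) \<mu>" for m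
    using extend_homogeneous[OF homogeneous_X_mode[OF homogeneous_basis[of \<nu>], of m b u i], of x V \<mu>]
    by (simp add: algebra_simps)
  have e: "fls_const x * fls_const (x powi (int (weight \<mu>) + (n - 1) - int (weight \<nu>))) = ?e"
  proof -
    have "x * x powi (int (weight \<mu>) + (n - 1) - int (weight \<nu>)) = x powi (int (weight \<mu>) + n - int (weight \<nu>))"
      using x power_int_add_1'[of x "int (weight \<mu>) + (n - 1) - int (weight \<nu>)"] by (simp add: algebra_simps)
    then show ?thesis by simp
  qed
  have "X_mode b v i n (V \<nu>) \<mu> - X_mode b v i (n - 1) (V \<nu>) \<mu>
      = extend V (X_mode b u i n (basis \<nu>)) \<mu>
        - (t_par b / q_par b) ^ i * extend V (X_mode b u i (n - 1) (basis \<nu>)) \<mu>"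
    using V i unfolding intertwiner_def by (simp only: fls_const_1 mult_1_left mult_1_right)
  moreover have "e * A - e * B = e * C - T * (e * D)" if "A - B = C - T * D" for A B C D T e :: hser
  proof -
    have "e * (A - B) = e * (C - T * D)" by (simp only: that)
    then show ?thesis by (simp only: right_diff_distrib mult.left_commute)
  qed
  ultimately have "?e * X_mode b v i n (V \<nu>) \<mu> - ?e * X_mode b v i (n - 1) (V \<nu>) \<mu>
      = ?e * extend V (X_mode b u i n (basis \<nu>)) \<mu>
        - (t_par b / q_par b) ^ i * (?e * extend V (X_mode b u i (n - 1) (basis \<nu>)) \<mu>)"
    by blast
  then show "X_mode b v i n (?W \<nu>) \<mu> - fls_const x * X_mode b v i (n - 1) (?W \<nu>) \<mu>
      = extend ?W (X_mode b u i n (basis \<nu>)) \<mu>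
        - (t_par b / q_par b) ^ i * fls_const x * extend ?W (X_mode b u i (n - 1) (basis \<nu>)) \<mu>"
    unfolding X E mult.assoc mult.assoc[of "fls_const x", symmetric] e .
qed

section \<open>The degree operator and the zero mode of L\<close>

lemma sum_modes_eq_weight:
  "weight \<mu> \<le> B \<Longrightarrow> (\<Sum>n\<in>{1..B}. n * (count \<mu> (One, n - 1) + count \<mu> (Two, n - 1))) = weight \<mu>"
proof (induction \<mu>)
  case (add p \<mu>)
  obtain i k where p: "p = (i, k)" by (cases p)
  have k: "Suc k \<le> B" using add.prems p by (simp add: weight_add_mset)
  have "(\<Sum>n\<in>{1..B}. n * (count (add_mset p \<mu>) (One, n - 1) + count (add_mset p \<mu>) (Two, n - 1)))
      = (\<Sum>n\<in>{1..B}. n * (count \<mu> (One, n - 1) + count \<mu> (Two, n - 1)) + (if n = Suc k then Suc k else 0))"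
    by (intro sum.cong) (cases i; auto simp: p algebra_simps)+
  also have "\<dots> = weight (add_mset p \<mu>)"
    using add k p by (simp add: sum.distrib weight_add_mset)
  finally show ?case .
qed (simp add: weight_def)

lemma boson_boson_diag:
  assumes "n > 0"
  shows "boson c i (- n) (boson c i n f) \<mu> = c * of_int n * of_nat (count \<mu> (i, nat n - 1)) * f \<mu>"
proof (cases "(i, nat n - 1) \<in># \<mu>")
  case True
  then obtain \<mu>' where \<mu>: "\<mu> = add_mset (i, nat n - 1) \<mu>'" by (metis insert_DiffM)
  with assms show ?thesis by (simp add: boson_def Let_def add.commute)
next
  case False
  moreover from this have "count \<mu> (i, nat n - 1) = 0" by (simp add: not_in_iff)
  ultimately show ?thesis using assms by (simp add: boson_def Let_def)
qed

text \<open>The quadratic parts of L_0 and of the Heisenberg degree are built on the difference and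
  the sum of the bosons. Added up, their cross terms cancel and the remaining number operators count
  the weight.\<close>

lemma L_0_plus_degree:
  assumes b: "b \<noteq> 0"
  shows "L_mode b w 0 f \<mu> + heis_degree b f \<mu>
    = ((Q_par b)\<^sup>2 / 4 - (w One - w Two)\<^sup>2 / 4 + of_nat (weight \<mu>)) * f \<mu>"
proof -
  let ?M = "int (weight \<mu>)"
  let ?a = "boson (- 1 / b\<^sup>2)"
  have q: "bquad b i j ?M 0 f \<mu> = 2 * (\<Sum>n\<in>{1..weight \<mu>}. ?a i (- int n) (?a j (int n) f) \<mu>)" for i j
  proof -
    have "(\<Sum>k\<in>{- ?M..- 1}. ?a i k (?a j (- k) f) \<mu>) = (\<Sum>n\<in>{1..weight \<mu>}. ?a i (- int n) (?a j (int n) f) \<mu>)"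
      by (rule sum.reindex_bij_witness[where i = "\<lambda>n. - int n" and j = "\<lambda>k. nat (- k)"]) auto
    then show ?thesis by (simp add: bquad_def qsum_def)
  qed
  have "heis_degree b f \<mu> = 2 * (\<Sum>n\<in>{1..weight \<mu>}. - (b\<^sup>2 / 4) *
     (?a One (- int n) (?a One (int n) f) \<mu> + ?a One (- int n) (?a Two (int n) f) \<mu>
      + ?a Two (- int n) (?a One (int n) f) \<mu> + ?a Two (- int n) (?a Two (int n) f) \<mu>))"
    unfolding heis_degree_def
  proof (intro arg_cong2[of _ _ _ _ "(*)"] refl sum.cong)
    fix n assume "n \<in> {1..weight \<mu>}"
    then have phi: "phi b w m g = (\<lambda>\<mu>. - b * (?a One m g \<mu> + ?a Two m g \<mu>))" if "m = int n \<or> m = - int n" for w m g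
      using that by (auto simp: phi_def)
    show "beta2 b (\<lambda>_. 0) (- int n) (beta2 b (\<lambda>_. 0) (int n) f) \<mu> = - (b\<^sup>2 / 4) *
     (?a One (- int n) (?a One (int n) f) \<mu> + ?a One (- int n) (?a Two (int n) f) \<mu>
      + ?a Two (- int n) (?a One (int n) f) \<mu> + ?a Two (- int n) (?a Two (int n) f) \<mu>)"
      unfolding beta2_phi phi_scale phi[OF disjI1[OF refl]] phi[OF disjI2[OF refl]] boson_scale boson_add
      by (simp add: power2_eq_square algebra_simps)
  qed
  then have heis: "heis_degree b f \<mu> = - (b\<^sup>2 / 4) * (bquad b One One ?M 0 f \<mu> + bquad b One Two ?M 0 f \<mu>
      + bquad b Two One ?M 0 f \<mu> + bquad b Two Two ?M 0 f \<mu>)"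
    unfolding q sum_distrib_left[symmetric] sum.distrib by (simp add: algebra_simps)
  have "L_mode b w 0 f \<mu> + heis_degree b f \<mu> = ((Q_par b)\<^sup>2 / 4 - (w One - w Two)\<^sup>2 / 4) * f \<mu>
      - b\<^sup>2 / 2 * (bquad b One One ?M 0 f \<mu> + bquad b Two Two ?M 0 f \<mu>)"
    unfolding L_mode_eq[OF b order.refl] heis by (simp add: algebra_simps)
  also have "b\<^sup>2 / 2 * (bquad b One One ?M 0 f \<mu> + bquad b Two Two ?M 0 f \<mu>)
      = b\<^sup>2 * (\<Sum>n\<in>{1..weight \<mu>}. ?a One (- int n) (?a One (int n) f) \<mu> + ?a Two (- int n) (?a Two (int n) f) \<mu>)"
    unfolding q sum.distrib by (simp add: algebra_simps)
  also have "b\<^sup>2 * (\<Sum>n\<in>{1..weight \<mu>}. ?a One (- int n) (?a One (int n) f) \<mu> + ?a Two (- int n) (?a Two (int n) f) \<mu>)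
      = (\<Sum>n\<in>{1..weight \<mu>}. - of_nat (n * (count \<mu> (One, n - 1) + count \<mu> (Two, n - 1))) * f \<mu>)"
    unfolding sum_distrib_left
    by (rule sum.cong) (use b in \<open>auto simp: boson_boson_diag field_simps\<close>)
  also have "\<dots> = - of_nat (weight \<mu>) * f \<mu>"
    unfolding sum_distrib_right[symmetric] sum_negf of_nat_sum[symmetric] sum_modes_eq_weight[OF order.refl] ..
  finally show ?thesis by (simp add: algebra_simps)
qed

section \<open>The commutators of the vertex operator\<close>

lemma int_geometric_zero:
  fixes d :: "int \<Rightarrow> complex"
  assumes "x \<noteq> 0" "d 0 = 0" "\<And>n. d n = x * d (n - 1)"
  shows "d n = 0"
proof (induction n rule: int_induct[where k = 0])
  case (step1 i)
  with assms(3)[of "i + 1"] show ?case by simp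
next
  case (step2 i)
  with assms(1) assms(3)[of i] show ?case by simp
qed (rule assms(2))

text \<open>Solution of the recurrence in \<open>intertwiner_phi_recurrence\<close> with value
  -2\<alpha> at n = 0; the inhomogeneity at n = 1 raises the prefactor by 2Q for all n > 0.\<close>

definition heis_eigenvalue :: "complex \<Rightarrow> complex \<Rightarrow> complex \<Rightarrow> int \<Rightarrow> complex" where
  "heis_eigenvalue b \<alpha> x n = (if n > 0 then 2 * (Q_par b - \<alpha>) else - 2 * \<alpha>) * x powi n"

lemma mult_powi_minus_1: "x \<noteq> 0 \<Longrightarrow> (x :: complex) * x powi (n - 1) = x powi n"
  using power_int_add_1'[of x "n - 1"] by simp

lemma heis_eigenvalue_rec:
  assumes "x \<noteq> 0"
  shows "heis_eigenvalue b \<alpha> x n - x * heis_eigenvalue b \<alpha> x (n - 1) = (if n = 1 then 2 * Q_par b * x else 0)"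
proof -
  have m: "x * (a * x powi (n - 1)) = a * x powi n" for a
    unfolding mult_powi_minus_1[OF assms, of n, symmetric] by (rule mult.left_commute)
  show ?thesis
    unfolding heis_eigenvalue_def m by (auto simp: algebra_simps)
qed

lemma phi_0: "phi b w 0 f = (\<lambda>\<mu>. (w One + w Two) * f \<mu>)"
  by (simp add: phi_def)

lemma extend_scale_basis: "extend V (\<lambda>\<mu>. a * basis \<nu> \<mu>) \<mu> = a * V \<nu> \<mu>"
proof -
  have "homogeneous (int (weight \<nu>)) (\<lambda>\<mu>. a * basis \<nu> \<mu>)" by (simp add: homogeneous_def basis_def)
  then show ?thesis by (simp add: extend_esum esum_scale esum_basis)
qed

context
  fixes b x \<alpha> :: complex and u v :: "idx \<Rightarrow> complex" and V :: "hser lmap" and V0 V1 V2 :: "complex lmap"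
  assumes b: "b \<noteq> 0" and x: "x \<noteq> 0" and V: "intertwiner b u v x V"
    and VJ: "\<And>\<nu>. vjet (V \<nu>) (V0 \<nu>) (V1 \<nu>) (V2 \<nu>)"
    and \<alpha>: "v One + v Two - (u One + u Two) = - 2 * \<alpha>"
begin

text \<open>The deviation from the eigenvalue obeys a homogeneous recurrence and vanishes at n = 0,
  where \<open>phi\<close> acts by scalars fixed by the labels.\<close>

lemma phi_commut: "commut (phi b v n) (phi b u n) V0 \<nu> \<mu> = heis_eigenvalue b \<alpha> x n * V0 \<nu> \<mu>"
proof -
  let ?d = "\<lambda>n. commut (phi b v n) (phi b u n) V0 \<nu> \<mu> - heis_eigenvalue b \<alpha> x n * V0 \<nu> \<mu>"
  have "?d n = 0"
  proof (rule int_geometric_zero[OF x])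
    have "commut (phi b v 0) (phi b u 0) V0 \<nu> \<mu> = (v One + v Two - (u One + u Two)) * V0 \<nu> \<mu>"
      unfolding commut_def phi_0 extend_scale_basis by (simp add: algebra_simps)
    then show "?d 0 = 0" unfolding \<alpha> by (simp add: heis_eigenvalue_def)
  next
    fix n
    have "(heis_eigenvalue b \<alpha> x n - x * heis_eigenvalue b \<alpha> x (n - 1)) * V0 \<nu> \<mu>
        = commut (phi b v n) (phi b u n) V0 \<nu> \<mu> - x * commut (phi b v (n - 1)) (phi b u (n - 1)) V0 \<nu> \<mu>"
      unfolding heis_eigenvalue_rec[OF x] intertwiner_phi_recurrence[OF b V VJ] by simp
    then show "?d n = x * ?d (n - 1)" by (simp add: algebra_simps)
  qed
  then show ?thesis by simp
qed

text \<open>The known commutators with \<open>phi\<close> are inserted into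
  \<open>intertwiner_L_recurrence\<close>. By \<open>heis_eigenvalue_rec\<close> the normal ordered
  sums for n and n - 1 collapse to a single operator term, which combines with \<open>phi\<close> of
  mode n - 1 into a scalar.\<close>

lemma L_commut_recurrence:
  "commut (L_mode b v n) (L_mode b u n) V0 \<nu> \<mu> - x * commut (L_mode b v (n - 1)) (L_mode b u (n - 1)) V0 \<nu> \<mu>
    = x powi n * (\<alpha> * (Q_par b - \<alpha>)) * V0 \<nu> \<mu>"
proof -
  \<comment> \<open>Beyond all weights involved: the cutoffs become harmless, and mode n + M of
    \<open>phi\<close> annihilates the monomial \<open>\<nu>\<close>.\<close>
  define M where "M = int (weight \<mu>) + int (weight \<nu>) + \<bar>n\<bar> + 2"
  have M: "int (weight \<mu>) \<le> M" "int (weight \<nu>) - n \<le> M" "int (weight \<nu>) - (n - 1) \<le> M"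
    "\<bar>n\<bar> \<le> M" "\<bar>n - 1\<bar> \<le> M" "n + M > 0" "int (weight \<nu>) - (n + M) < 0"
    by (auto simp: M_def)
  define h where "h = heis_eigenvalue b \<alpha> x"
  define R where "R k = extend V0 (phi b u k (basis \<nu>)) \<mu>" for k
  define L where "L k = phi b v k (V0 \<nu>) \<mu>" for k
  define S where "S k = (if k > 0 then R k else L k)" for k
  define Y where "Y = V0 \<nu> \<mu>"
  let ?Q = "Q_par b"
  let ?p = "2 * (?Q - \<alpha>)" and ?r = "- 2 * \<alpha>"
  let ?e = "\<lambda>n. (if n > 0 then ?p\<^sup>2 else ?r\<^sup>2) * of_int (n - 1) * x powi n * Y"
  define C where "C n = qsum M n (\<lambda>k. phi b v k (phi b v (n - k) (V0 \<nu>)) \<mu>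
      - extend V0 (phi b u k (phi b u (n - k) (basis \<nu>))) \<mu>)" for n
  define G where "G n = commut (L_mode b v n) (L_mode b u n) V0 \<nu> \<mu>" for n
  have arith: "g - x * g' = q * x * (r - s) - d / 4 + q / 2 * (a * y - a' * (x * y')) * Y - w"
    if "c - x * c' = 4 * q * x * s + d"
      and "(- g - c / 4 + q / 2 * a * (y * Y)) - x * (- g' - c' / 4 + q / 2 * a' * (y' * Y)) = - q * x * r + w"
    for g g' q r s d a a' y y' w c c' :: complex
  proof -
    have "c = x * c' + 4 * q * x * s + d" using that(1) by (simp add: algebra_simps)
    from that(2)[unfolded this] show ?thesis
      by (simp add: algebra_simps add_divide_distrib diff_divide_distrib)
  qed
  have xm: "x * (a * x powi (n - 1) * y) = a * x powi n * y" for a y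
    unfolding mult_powi_minus_1[OF x, of n, symmetric] by (simp only: mult_ac)
  have LR: "L k = R k + h k * Y" for k
    using phi_commut[of k \<nu> \<mu>] by (simp add: L_def R_def h_def Y_def commut_def algebra_simps)
  have C: "C m = 2 * (\<Sum>k\<in>{- M..m + M}. h (m - k) * S k) + ?e m" if "\<bar>m\<bar> \<le> M" for m
    unfolding C_def phi_phi_commut[of b v u V0 h, OF phi_commut[folded h_def]]
    using qsum_commut[OF x, of L R ?p ?r Y m M] that LR
    unfolding R_def[symmetric] L_def[symmetric] S_def h_def heis_eigenvalue_def by blast
  have "R (n + M) = 0"
    unfolding R_def homogeneous_neg[OF homogeneous_phi[OF homogeneous_basis] M(7)] by (simp add: extend_def)
  then have S0: "S (n + M) = 0" using M(6) by (simp add: S_def)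
  \<comment> \<open>The sums for n and n - 1 differ in range only by k = n + M, where
    \<open>S\<close> vanishes.\<close>
  have "{- M..n + M} = insert (n + M) {- M..n - 1 + M}" using M by auto
  then have "(\<Sum>k\<in>{- M..n - 1 + M}. h (n - 1 - k) * S k) = (\<Sum>k\<in>{- M..n + M}. h (n - 1 - k) * S k)"
    using S0 by simp
  moreover have idx: "n - 1 - k = n - k - 1" for k by simp
  ultimately have "(\<Sum>k\<in>{- M..n + M}. h (n - k) * S k) - x * (\<Sum>k\<in>{- M..n - 1 + M}. h (n - 1 - k) * S k)
      = (\<Sum>k\<in>{- M..n + M}. (h (n - k) - x * h (n - k - 1)) * S k)"
    by (simp only: sum_distrib_left sum_subtractf[symmetric] left_diff_distrib mult.assoc idx)
  also have "\<dots> = (\<Sum>k\<in>{- M..n + M}. if k = n - 1 then 2 * ?Q * x * S (n - 1) else 0)"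
    \<comment> \<open>The inhomogeneity of the eigenvalue recurrence sits at n - k = 1 only.\<close>
    unfolding h_def heis_eigenvalue_rec[OF x] by (intro sum.cong) auto
  also have "\<dots> = 2 * ?Q * x * S (n - 1)"
    using M by simp
  finally have "C n - x * C (n - 1) = 4 * ?Q * x * S (n - 1) + (?e n - x * ?e (n - 1))"
    unfolding C[OF M(4)] C[OF M(5)] by (simp add: algebra_simps)
  moreover have "(- G n - C n / 4 + ?Q / 2 * of_int n * (h n * Y))
      - x * (- G (n - 1) - C (n - 1) / 4 + ?Q / 2 * of_int (n - 1) * (h (n - 1) * Y))
      = - ?Q * x * R (n - 1) + (if n = 1 then ?Q\<^sup>2 * x * Y else 0)"
    using intertwiner_L_recurrence[OF b V VJ M(1-3)]
    unfolding phi_commut G_def C_def h_def Y_def R_def .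
  ultimately have "G n - x * G (n - 1) = ?Q * x * (R (n - 1) - S (n - 1)) - (?e n - x * ?e (n - 1)) / 4
      + ?Q / 2 * (of_int n * h n - of_int (n - 1) * (x * h (n - 1))) * Y - (if n = 1 then ?Q\<^sup>2 * x * Y else 0)"
    by (rule arith)
  \<comment> \<open>For n > 1 the surviving mode already stands on the right; otherwise moving it
    there leaves a scalar.\<close>
  moreover have "R (n - 1) - S (n - 1) = (if n - 1 > 0 then 0 else - h (n - 1) * Y)"
    by (simp add: S_def LR)
  moreover have xh: "x * h (n - 1) = (if n - 1 > 0 then ?p else ?r) * x powi n"
    unfolding h_def heis_eigenvalue_def using mult_powi_minus_1[OF x, of n] by (simp add: algebra_simps)
  moreover have "x * ?e (n - 1) = (if n - 1 > 0 then ?p\<^sup>2 else ?r\<^sup>2) * of_int (n - 2) * x powi n * Y"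
    unfolding xm by simp
  moreover have "?Q * x * (if n - 1 > 0 then 0 else - h (n - 1) * Y) = (if n - 1 > 0 then 0 else - ?Q * (x * h (n - 1)) * Y)"
    by simp
  ultimately have "G n - x * G (n - 1) = (if n - 1 > 0 then 0 else - ?Q * ((if n - 1 > 0 then ?p else ?r) * x powi n) * Y)
      - (?e n - (if n - 1 > 0 then ?p\<^sup>2 else ?r\<^sup>2) * of_int (n - 2) * x powi n * Y) / 4
      + ?Q / 2 * (of_int n * h n - of_int (n - 1) * ((if n - 1 > 0 then ?p else ?r) * x powi n)) * Y
      - (if n = 1 then ?Q\<^sup>2 * x * Y else 0)"
    by (simp only:)
  also have "\<dots> = x powi n * (\<alpha> * (?Q - \<alpha>)) * Y"
  proof -
    \<comment> \<open>At n = 1 the prefactors for n and n - 1 differ and the Q^2 term is present, so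
      this case is separate.\<close>
    consider "n > 1" | "n = 1" | "n \<le> 0" by linarith
    then show ?thesis
      by cases (simp_all add: h_def heis_eigenvalue_def power2_eq_square field_simps)
  qed
  finally show ?thesis unfolding G_def Y_def .
qed

text \<open>By \<open>L_0_plus_degree\<close> the sum of the two operators is diagonal on both
  spaces, so the commutator is the difference of the eigenvalues at \<open>\<mu>\<close> and
  \<open>\<nu>\<close>.\<close>

lemma L_0_commut:
  "commut (L_mode b v 0) (L_mode b u 0) V0 \<nu> \<mu> + commut (heis_degree b) (heis_degree b) V0 \<nu> \<mu>
   = ((u One - u Two)\<^sup>2 / 4 - (v One - v Two)\<^sup>2 / 4 + of_nat (weight \<mu>) - of_nat (weight \<nu>)) * V0 \<nu> \<mu>"
proof -
  let ?d = "int (weight \<nu>)"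
  let ?c = "\<lambda>w. (Q_par b)\<^sup>2 / 4 - (w One - w Two)\<^sup>2 / 4"
  have L: "homogeneous ?d (L_mode b u 0 (basis \<nu>))"
    using homogeneous_L_mode[OF homogeneous_basis[of \<nu>], of 0 b u] by simp
  have H: "heis_degree b (basis \<nu>) = (\<lambda>\<mu>. (?c u + of_nat (weight \<nu>)) * basis \<nu> \<mu> - L_mode b u 0 (basis \<nu>) \<mu>)"
  proof
    fix \<mu>'
    show "heis_degree b (basis \<nu>) \<mu>' = (?c u + of_nat (weight \<nu>)) * basis \<nu> \<mu>' - L_mode b u 0 (basis \<nu>) \<mu>'"
      using L_0_plus_degree[OF b, of u "basis \<nu>" \<mu>'] by (auto simp: basis_def algebra_simps split: if_splits)
  qed
  have hH: "homogeneous ?d (heis_degree b (basis \<nu>))"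
    using L unfolding H by (auto simp: homogeneous_def basis_def)
  have "extend V0 (L_mode b u 0 (basis \<nu>)) \<mu> + extend V0 (heis_degree b (basis \<nu>)) \<mu>
      = (?c u + of_nat (weight \<nu>)) * V0 \<nu> \<mu>"
    unfolding extend_esum[OF L] extend_esum[OF hH] unfolding H esum_diff esum_scale esum_basis[OF refl] by simp
  with L_0_plus_degree[OF b, of v "V0 \<nu>" \<mu>] show ?thesis
    by (simp add: commut_def algebra_simps)
qed

text \<open>n x^n \<alpha>(Q - \<alpha>) times \<open>V0\<close> is a particular solution of
  \<open>L_commut_recurrence\<close>; the homogeneous part is fixed by n = 0.\<close>

lemma L_commut:
  "commut (L_mode b v n) (L_mode b u n) V0 \<nu> \<mu>
   = x powi n * (commut (L_mode b v 0) (L_mode b u 0) V0 \<nu> \<mu> + \<alpha> * (Q_par b - \<alpha>) * of_int n * V0 \<nu> \<mu>)"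
proof -
  let ?G = "\<lambda>n. commut (L_mode b v n) (L_mode b u n) V0 \<nu> \<mu>"
  let ?d = "\<lambda>n. ?G n - x powi n * (?G 0 + \<alpha> * (Q_par b - \<alpha>) * of_int n * V0 \<nu> \<mu>)"
  have "?d n = 0"
  proof (rule int_geometric_zero[OF x])
    fix n
    have d: "x * ?d (n - 1) = x * ?G (n - 1) - x powi n * (?G 0 + \<alpha> * (Q_par b - \<alpha>) * of_int (n - 1) * V0 \<nu> \<mu>)"
      unfolding right_diff_distrib mult.assoc[of x, symmetric] mult_powi_minus_1[OF x] ..
    show "?d n = x * ?d (n - 1)"
      unfolding d using L_commut_recurrence[of n \<nu> \<mu>] by (simp add: algebra_simps)
  qed simp
  then show ?thesis by simp
qed

end

section \<open>Transfer from the constant coefficient to Phi\<close>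

lemma commut_scale:
  assumes "\<And>f. A (\<lambda>\<mu>. e * f \<mu>) = (\<lambda>\<mu>. e * A f \<mu>)"
  shows "commut A B (\<lambda>\<nu> \<mu>. e * F \<nu> \<mu>) \<nu> \<mu> = e * commut A B F \<nu> \<mu>"
  unfolding commut_def assms extend_def
  by (simp add: right_diff_distrib sum_distrib_left mult_ac)

lemma L_mode_scale: "L_mode b w n (\<lambda>\<mu>. e * f \<mu>) = (\<lambda>\<mu>. e * L_mode b w n f \<mu>)"
  using L_mode_twist[of b w n "\<lambda>_. e" f] by (simp add: twist_def)

lemma beta2_scale: "beta2 b w n (\<lambda>\<mu>. e * f \<mu>) = (\<lambda>\<mu>. e * beta2 b w n f \<mu>)"
  unfolding beta2_phi phi_scale by (simp add: mult.left_commute)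

lemma heis_degree_scale: "heis_degree b (\<lambda>\<mu>. e * f \<mu>) = (\<lambda>\<mu>. e * heis_degree b f \<mu>)"
  by (rule ext) (simp add: heis_degree_def beta2_scale sum_distrib_left mult.left_commute)

lemma commut_beta2: "commut (beta2 b v n) (beta2 b u n) F \<nu> \<mu> = \<i> / 2 * commut (phi b v n) (phi b u n) F \<nu> \<mu>"
proof -
  have h: "homogeneous (int (weight \<nu>) - n) (phi b u n (basis \<nu>))" by (rule homogeneous_phi[OF homogeneous_basis])
  then have h': "homogeneous (int (weight \<nu>) - n) (\<lambda>\<mu>. \<i> / 2 * phi b u n (basis \<nu>) \<mu>)" by (simp add: homogeneous_def)
  show ?thesis
    unfolding commut_def beta2_phi extend_esum[OF h] extend_esum[OF h'] esum_scale by (simp add: algebra_simps)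
qed

text \<open>The facts taken as known about the vertex operator are the assumptions
  \<open>ex_unique\<close> and \<open>no_pole\<close>. Complex powers are formed on an open set with
  a holomorphic logarithm; differentiability is part of the claim, so that \<open>deriv\<close> in
  \<open>vir_deriv\<close> has its usual meaning.\<close>

theorem theorem5p25:
  fixes b P P' \<alpha> :: complex and u v :: "idx \<Rightarrow> complex"
    and S :: "complex set" and lg :: "complex \<Rightarrow> complex"
  defines "\<Phi> \<equiv> Phi_HV b P P' \<alpha> u v lg"
  assumes gen: "generic b P P'"
    and labels: "v One - u One = P' - P - \<alpha>" "v One - u Two = P' + P - \<alpha>"
      "v Two - u One = - P' - P - \<alpha>" "v Two - u Two = - P' + P - \<alpha>"
    and ex_unique: "\<And>x. x \<noteq> 0 \<Longrightarrow> \<exists>!V. intertwiner b u v x V"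
    and no_pole: "\<And>x \<nu> \<mu> k. x \<noteq> 0 \<Longrightarrow> k < 0 \<Longrightarrow> fls_nth (vertex_op b u v x \<nu> \<mu>) k = 0"
    and branch: "open S" "lg holomorphic_on S" "\<And>z. z \<in> S \<Longrightarrow> exp (lg z) = z"
  shows "\<forall>z\<in>S.
      (\<forall>\<nu> \<mu>. (\<lambda>y. \<Phi> y \<nu> \<mu>) field_differentiable at z)
    \<and> (\<forall>(n::int) \<nu> \<mu>. commut (L_mode b v n) (L_mode b u n) (\<Phi> z) \<nu> \<mu>
         = z powi n * (vir_deriv b \<Phi> z \<nu> \<mu> + \<alpha> * (Q_par b - \<alpha>) * of_int (n + 1) * \<Phi> z \<nu> \<mu>))
    \<and> (\<forall>(n::int) \<nu> \<mu>. n > 0 \<longrightarrow> commut (beta2 b v n) (beta2 b u n) (\<Phi> z) \<nu> \<mu>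
         = \<i> * z powi n * (Q_par b - \<alpha>) * \<Phi> z \<nu> \<mu>)
    \<and> (\<forall>(n::int) \<nu> \<mu>. n \<ge> 0 \<longrightarrow> commut (beta2 b v (- n)) (beta2 b u (- n)) (\<Phi> z) \<nu> \<mu>
         = - \<i> * z powi (- n) * \<alpha> * \<Phi> z \<nu> \<mu>)"
proof
  fix z assume z: "z \<in> S"
  have S_nz: "y \<noteq> 0" if "y \<in> S" for y
    using branch(3)[OF that] by (metis exp_not_eq_zero)
  note z0 = S_nz[OF z]
  have b: "b \<noteq> 0" using gen by (simp add: generic_def)
  have PP: "u One - u Two = 2 * P" "v One - v Two = 2 * P'"
    and \<alpha>: "v One + v Two - (u One + u Two) = - 2 * \<alpha>"
  proof -
    have "u One - u Two = (v One - u Two) - (v One - u One)"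
      "v One - v Two = (v One - u One) - (v Two - u One)"
      "v One + v Two - (u One + u Two) = (v One - u One) + (v Two - u Two)" by simp_all
    then show "u One - u Two = 2 * P" "v One - v Two = 2 * P'"
      "v One + v Two - (u One + u Two) = - 2 * \<alpha>"
      unfolding labels by simp_all
  qed
  have V: "intertwiner b u v y (vertex_op b u v y)" if "y \<noteq> 0" for y
    unfolding vertex_op_def using ex_unique[OF that] by (rule theI')
  define c where "c = - P'\<^sup>2 + P\<^sup>2 - \<alpha> * (Q_par b - \<alpha>)"
  define W where "W = (\<lambda>k \<nu> \<mu>. fls_nth (vertex_op b u v z \<nu> \<mu>) k)"
  define e where "e = exp (c * lg z)"
  have VJ: "vjet (vertex_op b u v z \<nu>) (W 0 \<nu>) (W 1 \<nu>) (W 2 \<nu>)" for \<nu>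
    unfolding vjet_def W_def using no_pole[OF z0] by (intro allI jet_regular)
  have \<Phi>: "\<Phi> z = (\<lambda>\<nu> \<mu>. e * W 0 \<nu> \<mu>)"
    by (simp add: \<Phi>_def Phi_HV_def e_def W_def c_def)
  \<comment> \<open>By uniqueness the operator at y is the rescaled operator at 1, so each matrix
    element is a constant times an integer power of y.\<close>
  have scaling: "fls_nth (vertex_op b u v y \<nu> \<mu>) 0
      = y powi (int (weight \<mu>) - int (weight \<nu>)) * fls_nth (vertex_op b u v 1 \<nu> \<mu>) 0" if "y \<noteq> 0" for y \<nu> \<mu>
  proof -
    have "vertex_op b u v y = (\<lambda>\<nu> \<mu>. fls_const (y powi (int (weight \<mu>) - int (weight \<nu>))) * vertex_op b u v 1 \<nu> \<mu>)"
      using ex_unique[OF that] V[OF that] intertwiner_rescale[OF V[of 1] that] by auto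
    then show ?thesis by simp
  qed
  have deriv: "((\<lambda>y. \<Phi> y \<nu> \<mu>) has_field_derivative
      (c + of_int (int (weight \<mu>) - int (weight \<nu>))) * \<Phi> z \<nu> \<mu> / z) (at z)" for \<nu> \<mu>
  proof -
    let ?m = "int (weight \<mu>) - int (weight \<nu>)" and ?K = "fls_nth (vertex_op b u v 1 \<nu> \<mu>) 0"
    obtain l where l: "(lg has_field_derivative l) (at z)"
      using branch(1,2) z holomorphic_on_open by blast
    \<comment> \<open>Differentiating exp(lg y) = y on \<open>S\<close> gives the derivative 1/z of
      the branch.\<close>
    have "((\<lambda>y. exp (lg y)) has_field_derivative exp (lg z) * l) (at z)"
      by (rule derivative_eq_intros l refl)+
    then have "((\<lambda>y. y) has_field_derivative exp (lg z) * l) (at z)"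
      by (rule has_field_derivative_transform_within_open[OF _ branch(1) z]) (rule branch(3))
    then have "z * l = 1"
      using DERIV_unique[OF _ DERIV_ident] branch(3)[OF z] by metis
    then have l_eq: "l = 1 / z" using z0 by (simp add: field_simps)
    have "((\<lambda>y. exp (c * lg y) * (y powi ?m * ?K)) has_field_derivative
        exp (c * lg z) * (c * l) * (z powi ?m * ?K) + (of_int ?m * z powi (?m - 1) * 1 * ?K) * exp (c * lg z)) (at z)"
      using z0 by (auto intro!: derivative_eq_intros l)
    also have "exp (c * lg z) * (c * l) * (z powi ?m * ?K) + (of_int ?m * z powi (?m - 1) * 1 * ?K) * exp (c * lg z)
        = (c + of_int ?m) * (exp (c * lg z) * (z powi ?m * ?K)) / z"
    proof -
      have p: "z powi (?m - 1) = z powi ?m / z"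
        using z0 mult_powi_minus_1[OF z0, of ?m] by (simp add: field_simps)
      show ?thesis unfolding p l_eq using z0 by (simp add: field_simps)
    qed
    also have "exp (c * lg z) * (z powi ?m * ?K) = \<Phi> z \<nu> \<mu>"
      by (simp add: \<Phi> e_def W_def scaling[OF z0])
    finally show ?thesis
    proof (rule has_field_derivative_transform_within_open[OF _ branch(1) z])
      fix y assume "y \<in> S"
      show "exp (c * lg y) * (y powi ?m * ?K) = \<Phi> y \<nu> \<mu>"
        unfolding \<Phi>_def Phi_HV_def c_def scaling[OF S_nz[OF \<open>y \<in> S\<close>], of \<nu> \<mu>] by (rule refl)
    qed
  qed
  have LC: "commut (L_mode b v n) (L_mode b u n) (\<Phi> z) \<nu> \<mu> = e * commut (L_mode b v n) (L_mode b u n) (W 0) \<nu> \<mu>" for n \<nu> \<mu>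
    unfolding \<Phi> by (rule commut_scale) (rule L_mode_scale)
  have BC: "commut (beta2 b v n) (beta2 b u n) (\<Phi> z) \<nu> \<mu> = \<i> / 2 * heis_eigenvalue b \<alpha> z n * \<Phi> z \<nu> \<mu>" for n \<nu> \<mu>
    unfolding commut_beta2 \<Phi> commut_scale[where A = "phi b v n", OF phi_scale] phi_commut[OF b z0 V[OF z0] VJ \<alpha>]
    by simp
  \<comment> \<open>The derivative yields \<open>c\<close> plus the difference of weights. Here P^2
    - P'^2 and the weights form the commutator with L_0 plus the degree; subtracting the degree
    leaves L_0, and -\<alpha>(Q - \<alpha>) remains from \<open>c\<close>.\<close>
  have vir: "vir_deriv b \<Phi> z \<nu> \<mu> = e * commut (L_mode b v 0) (L_mode b u 0) (W 0) \<nu> \<mu> - \<alpha> * (Q_par b - \<alpha>) * \<Phi> z \<nu> \<mu>" for \<nu> \<mu>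
  proof -
    have H: "commut (heis_degree b) (heis_degree b) (\<Phi> z) \<nu> \<mu> = e * commut (heis_degree b) (heis_degree b) (W 0) \<nu> \<mu>"
      unfolding \<Phi> by (rule commut_scale) (rule heis_degree_scale)
    have zd: "z * deriv (\<lambda>y. \<Phi> y \<nu> \<mu>) z = (c + of_int (int (weight \<mu>) - int (weight \<nu>))) * \<Phi> z \<nu> \<mu>"
      using z0 DERIV_imp_deriv[OF deriv, of \<nu> \<mu>] by simp
    have "e * (commut (L_mode b v 0) (L_mode b u 0) (W 0) \<nu> \<mu> + commut (heis_degree b) (heis_degree b) (W 0) \<nu> \<mu>)
        = e * (((2 * P)\<^sup>2 / 4 - (2 * P')\<^sup>2 / 4 + of_nat (weight \<mu>) - of_nat (weight \<nu>)) * W 0 \<nu> \<mu>)"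
      unfolding L_0_commut[OF b z0 V[OF z0] VJ \<alpha>] PP ..
    then show ?thesis
      unfolding vir_deriv_def H zd by (simp add: \<Phi> c_def algebra_simps power2_eq_square)
  qed
  show "(\<forall>\<nu> \<mu>. (\<lambda>y. \<Phi> y \<nu> \<mu>) field_differentiable at z)
    \<and> (\<forall>(n::int) \<nu> \<mu>. commut (L_mode b v n) (L_mode b u n) (\<Phi> z) \<nu> \<mu>
         = z powi n * (vir_deriv b \<Phi> z \<nu> \<mu> + \<alpha> * (Q_par b - \<alpha>) * of_int (n + 1) * \<Phi> z \<nu> \<mu>))
    \<and> (\<forall>(n::int) \<nu> \<mu>. n > 0 \<longrightarrow> commut (beta2 b v n) (beta2 b u n) (\<Phi> z) \<nu> \<mu>
         = \<i> * z powi n * (Q_par b - \<alpha>) * \<Phi> z \<nu> \<mu>)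
    \<and> (\<forall>(n::int) \<nu> \<mu>. n \<ge> 0 \<longrightarrow> commut (beta2 b v (- n)) (beta2 b u (- n)) (\<Phi> z) \<nu> \<mu>
         = - \<i> * z powi (- n) * \<alpha> * \<Phi> z \<nu> \<mu>)"
  proof (intro conjI allI impI)
    show "(\<lambda>y. \<Phi> y \<nu> \<mu>) field_differentiable at z" for \<nu> \<mu>
      using deriv by (auto simp: field_differentiable_def)
    show "commut (L_mode b v n) (L_mode b u n) (\<Phi> z) \<nu> \<mu>
         = z powi n * (vir_deriv b \<Phi> z \<nu> \<mu> + \<alpha> * (Q_par b - \<alpha>) * of_int (n + 1) * \<Phi> z \<nu> \<mu>)" for n \<nu> \<mu>
      unfolding LC vir L_commut[OF b z0 V[OF z0] VJ \<alpha>, of n] by (simp add: \<Phi> algebra_simps)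
    show "commut (beta2 b v n) (beta2 b u n) (\<Phi> z) \<nu> \<mu> = \<i> * z powi n * (Q_par b - \<alpha>) * \<Phi> z \<nu> \<mu>"
      if "n > 0" for n \<nu> \<mu>
      using that unfolding BC by (simp add: heis_eigenvalue_def algebra_simps)
    show "commut (beta2 b v (- n)) (beta2 b u (- n)) (\<Phi> z) \<nu> \<mu> = - \<i> * z powi (- n) * \<alpha> * \<Phi> z \<nu> \<mu>"
      if "n \<ge> 0" for n \<nu> \<mu>
      using that unfolding BC by (simp add: heis_eigenvalue_def algebra_simps)
  qed
qed

end
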